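(* Let $d$ be a positive integer and let $Q_d$ denote the $d$-cube. Then $Q_d$ is determined by its distance spectrum: every connected graph whose distance matrix has the same spectrum (eigenvalues with multiplicities) as the distance matrix of $Q_d$ is isomorphic to $Q_d$.
   Context: All graphs are finite, simple and undirected. The $d$-cube $Q_d$ (the Hamming graph $H(d,2)$) has as vertices the $d$-tuples with entries in $\{0,1\}$, two tuples being adjacent iff they differ in exactly one coordinate. For a connected graph $\Gamma$, the distance $d(x,y)$ is the length of a shortest path between $x$ and $y$; the distance matrix $\mathcal{D}(\Gamma)$ is the symmetric matrix indexed by the vertices with $(x,y)$-entry $d(x,y)$. The distance spectrum of $\Gamma$ is the multiset of eigenvalues of $\mathcal{D}(\Gamma)$. Two connected graphs are distance cospectral if their distance spectra coincide; a connected graph $\Gamma$ is determined by its distance spectrum if every connected graph distance cospectral with $\Gamma$ is isomorphic to $\Gamma$. *)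

theory Defs
  imports
    "Graph_Theory.Pair_Digraph"
    "Graph_Theory.Digraph_Component"
    "Graph_Theory.Digraph_Isomorphism"
    "Jordan_Normal_Form.Char_Poly"
    "HOL-Computational_Algebra.Polynomial"
begin

text \<open>
  A finite simple undirected graph is a \<^locale>\<open>pair_graph\<close>: finite, loop-free and with a symmetric
  set of arcs, each edge being represented by its two arcs.
\<close>

definition hypercube :: "nat \<Rightarrow> nat list pair_pre_digraph" where
  "hypercube d =
     (let V = {x. length x = d \<and> set x \<subseteq> {0, 1}}
      in \<lparr> pverts = V,
           parcs = {(x, y). x \<in> V \<and> y \<in> V \<and> card {i. i < d \<and> x ! i \<noteq> y ! i} = 1} \<rparr>)"

text \<open>
  The list \<open>p\<close> below consists of arcs, so its length is the number of edges of the path. The value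
  is meaningful only if \<open>v\<close> is reachable from \<open>u\<close>.
\<close>

definition graph_dist :: "'a pair_pre_digraph \<Rightarrow> 'a \<Rightarrow> 'a \<Rightarrow> nat" where
  "graph_dist G u v = (LEAST n. \<exists>p. pre_digraph.apath (with_proj G) u p v \<and> length p = n)"

text \<open>
  Matrices of \<open>Jordan_Normal_Form\<close> are indexed by natural numbers, so the vertices are first listed
  in some order. Another order conjugates the distance matrix by a permutation matrix, which does
  not affect its spectrum.
\<close>

definition vertex_list :: "'a pair_pre_digraph \<Rightarrow> 'a list" where
  "vertex_list G = (SOME vs. distinct vs \<and> set vs = pverts G)"

definition distance_matrix :: "'a pair_pre_digraph \<Rightarrow> real mat" where
  "distance_matrix G =
     (let vs = vertex_list G
      in mat (length vs) (length vs) (\<lambda>(i, j). real (graph_dist G (vs ! i) (vs ! j))))"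

text \<open>
  The distance matrix is real symmetric, so its characteristic polynomial splits over the reals and
  no eigenvalue is lost by taking real roots only.
\<close>

definition distance_spectrum :: "'a pair_pre_digraph \<Rightarrow> real multiset" where
  "distance_spectrum G = proots (char_poly (distance_matrix G))"

definition distance_cospectral :: "'a pair_pre_digraph \<Rightarrow> 'b pair_pre_digraph \<Rightarrow> bool" where
  "distance_cospectral G H \<longleftrightarrow> distance_spectrum G = distance_spectrum H"

end

theory Submission
  imports Defs "Jordan_Normal_Form.Schur_Decomposition" "HOL-Analysis.Convex"
begin

text \<open>
  Put \<open>n = 2\<^sup>d\<close>. The distance matrix of the cube satisfies \<open>D\<^sup>2 + (n/2) D = c J\<close> and has constant row sums
  \<open>\<theta> = nd/2\<close>, so its eigenvalues lie in \<open>{\<theta>, 0, -n/2}\<close>. For a cospectral \<open>G\<close> this gives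
  \<open>D (D - \<theta>) (D + n/2) = 0\<close>, hence \<open>B = D\<^sup>2 + (n/2) D\<close> is a multiple of a projection; its trace is the sum
  of the squared eigenvalues, which forces \<open>B\<close> to have rank one. Comparing the rows of
  adjacent vertices shows that \<open>G\<close> is bipartite and \<open>B\<close> is constant. The difference of the two rows
  of \<open>D\<close> belonging to an arc is then a \<open>\<plusminus>1\<close>-vector, two such vectors are parallel or orthogonal,
  and at most \<open>d\<close> of them are pairwise orthogonal. Their signs are the coordinates of an
  isomorphism onto the cube.
\<close>

section \<open>The spectrum of a real symmetric matrix\<close>

lemma diag_mult_upper_triangular:
  fixes A B :: "'a::semiring_1 mat"
  assumes "A \<in> carrier_mat n n" "B \<in> carrier_mat n n"
    and "upper_triangular A" "upper_triangular B" and i: "i < n"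
  shows "(A * B) $$ (i, i) = A $$ (i, i) * B $$ (i, i)"
proof -
  have z: "A $$ (i, k) * B $$ (k, i) = 0" if "k < n" "k \<noteq> i" for k
  proof (cases "k < i")
    case True
    then show ?thesis using assms by (auto simp: upper_triangular_def)
  next
    case False
    then show ?thesis using assms that by (auto simp: upper_triangular_def)
  qed
  have "(A * B) $$ (i, i) = (\<Sum>k<n. A $$ (i, k) * B $$ (k, i))"
    using assms by (auto simp: scalar_prod_def lessThan_atLeast0)
  also have "\<dots> = (\<Sum>k\<in>{i}. A $$ (i, k) * B $$ (k, i))"
    by (rule sum.mono_neutral_right) (use i z in auto)
  finally show ?thesis by simp
qed

lemma upper_triangular_mult:
  fixes A B :: "'a::semiring_1 mat"
  assumes "A \<in> carrier_mat n n" "B \<in> carrier_mat n n"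
    and "upper_triangular A" "upper_triangular B"
  shows "upper_triangular (A * B)"
proof (rule upper_triangularI)
  fix i j assume ij: "j < i" "i < dim_row (A * B)"
  have z: "A $$ (i, k) * B $$ (k, j) = 0" if "k < n" for k
  proof (cases "k < i")
    case True
    then show ?thesis using assms ij by (auto simp: upper_triangular_def)
  next
    case False
    then show ?thesis using assms that ij by (auto simp: upper_triangular_def)
  qed
  show "(A * B) $$ (i, j) = 0"
    using assms ij by (auto simp: scalar_prod_def intro!: sum.neutral z)
qed

section \<open>Traces, conjugation and real eigenvalues\<close>

lemma sum_diag_mult_commute:
  fixes A B :: "'a::comm_semiring_1 mat"
  assumes "A \<in> carrier_mat n m" "B \<in> carrier_mat m n"
  shows "(\<Sum>i<n. (A * B) $$ (i, i)) = (\<Sum>i<m. (B * A) $$ (i, i))"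
proof -
  have "(\<Sum>i<n. (A * B) $$ (i, i)) = (\<Sum>i<n. \<Sum>k<m. A $$ (i, k) * B $$ (k, i))"
    using assms by (auto simp: scalar_prod_def lessThan_atLeast0)
  also have "\<dots> = (\<Sum>k<m. \<Sum>i<n. B $$ (k, i) * A $$ (i, k))"
    by (subst sum.swap) (simp add: mult.commute)
  also have "\<dots> = (\<Sum>i<m. (B * A) $$ (i, i))"
    using assms by (auto simp: scalar_prod_def lessThan_atLeast0)
  finally show ?thesis .
qed

text \<open>The sum of the diagonal entries is the trace, and its cyclicity brings \<open>Q\<close>
  next to \<open>P\<close>.\<close>

lemma sum_diag_conjugate:
  fixes P Q T :: "'a::comm_ring_1 mat"
  assumes "P \<in> carrier_mat n n" "Q \<in> carrier_mat n n" "T \<in> carrier_mat n n" "Q * P = 1\<^sub>m n"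
  shows "(\<Sum>i<n. (P * T * Q) $$ (i, i)) = (\<Sum>i<n. T $$ (i, i))"
proof -
  have "Q * (P * T) = T"
    using assoc_mult_mat[OF assms(2,1,3)] left_mult_one_mat[OF assms(3)] assms(4) by simp
  then show ?thesis
    using sum_diag_mult_commute[of "P * T" n n Q] assms by auto
qed

lemma conjugate_mult:
  fixes P Q T :: "'a::comm_ring_1 mat"
  assumes "P \<in> carrier_mat n n" "Q \<in> carrier_mat n n" "T \<in> carrier_mat n n" "S \<in> carrier_mat n n"
    "Q * P = 1\<^sub>m n"
  shows "(P * T * Q) * (P * S * Q) = P * (T * S) * Q"
proof -
  have "(P * T * Q) * (P * S * Q) = P * T * (Q * P) * (S * Q)"
    using assms(1-4) by (simp add: assoc_mult_mat[of _ n n _ n _ n])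
  then show ?thesis
    using assms by (simp add: assoc_mult_mat[of _ n n _ n _ n])
qed

lemma conjugate_add:
  fixes P Q T :: "'a::comm_ring_1 mat"
  assumes "P \<in> carrier_mat n n" "Q \<in> carrier_mat n n" "T \<in> carrier_mat n n" "S \<in> carrier_mat n n"
  shows "P * T * Q + P * S * Q = P * (T + S) * Q"
  using assms by (simp add: mult_add_distrib_mat[of _ n n _ n] add_mult_distrib_mat[of _ n n _ _ n])

lemma conjugate_smult:
  fixes P Q T :: "'a::comm_ring_1 mat"
  assumes "P \<in> carrier_mat n n" "Q \<in> carrier_mat n n" "T \<in> carrier_mat n n"
  shows "c \<cdot>\<^sub>m (P * T * Q) = P * (c \<cdot>\<^sub>m T) * Q"
  using assms by (simp add: mult_smult_distrib[of _ n n _ n] mult_smult_assoc_mat[of _ n n _ n])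

text \<open>For an eigenvector \<open>v\<close> the form \<open>q\<close> is its own conjugate,
  because \<open>A\<close> is real and symmetric. It also equals \<open>a\<close> times the squared
  norm \<open>r\<close> of \<open>v\<close>, a nonzero real number.\<close>

lemma eigenvalue_symmetric_real:
  fixes A :: "real mat"
  assumes A: "A \<in> carrier_mat n n" and sym: "transpose_mat A = A"
    and ev: "eigenvalue (map_mat complex_of_real A) a"
  shows "a \<in> \<real>"
proof -
  let ?C = "map_mat complex_of_real A"
  obtain v where v: "v \<in> carrier_vec n" "v \<noteq> 0\<^sub>v n" "?C *\<^sub>v v = a \<cdot>\<^sub>v v"
    using ev A by (auto simp: eigenvalue_def eigenvector_def)
  have s: "A $$ (i, j) = A $$ (j, i)" if "i < n" "j < n" for i j
    using arg_cong[OF sym, of "\<lambda>M. M $$ (i, j)"] that A by simp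
  have e: "(\<Sum>j<n. of_real (A $$ (i, j)) * v $ j) = a * v $ i" if "i < n" for i
    using arg_cong[OF v(3), of "\<lambda>w. w $ i"] that A v(1)
    by (simp add: scalar_prod_def lessThan_atLeast0)
  define q where "q = (\<Sum>i<n. \<Sum>j<n. cnj (v $ i) * of_real (A $$ (i, j)) * v $ j)"
  define r where "r = (\<Sum>i<n. cnj (v $ i) * v $ i)"
  have "q = (\<Sum>i<n. cnj (v $ i) * (\<Sum>j<n. of_real (A $$ (i, j)) * v $ j))"
    by (simp add: q_def sum_distrib_left mult.assoc)
  also have "\<dots> = (\<Sum>i<n. cnj (v $ i) * (a * v $ i))"
    by (simp add: e)
  also have "\<dots> = a * r"
    by (simp add: r_def sum_distrib_left mult_ac)
  finally have q: "q = a * r" .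
  have "cnj q = (\<Sum>i<n. \<Sum>j<n. v $ i * of_real (A $$ (i, j)) * cnj (v $ j))"
    by (simp add: q_def)
  also have "\<dots> = q"
    unfolding q_def by (subst sum.swap) (auto intro!: sum.cong simp: s mult_ac)
  finally have cq: "cnj q = q" .
  have rr: "r = of_real (\<Sum>i<n. (cmod (v $ i))\<^sup>2)"
    unfolding r_def of_real_sum
    by (intro sum.cong refl) (metis complex_norm_square mult.commute)
  obtain i where i: "i < n" "v $ i \<noteq> 0"
    using v(1,2) by (metis carrier_vecD eq_vecI index_zero_vec(1) index_zero_vec(2))
  have "0 < (cmod (v $ i))\<^sup>2" using i by simp
  also have "\<dots> \<le> (\<Sum>i<n. (cmod (v $ i))\<^sup>2)"
    by (rule member_le_sum) (use i in auto)
  finally have "r \<noteq> 0" using rr by (metis less_irrefl of_real_eq_0_iff)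
  moreover have "cnj r = r" using rr by simp
  ultimately have "cnj a = a" using q cq by auto
  then show ?thesis by (simp add: Reals_cnj_iff)
qed

text \<open>The polynomial factors over the complex numbers, all roots are real by the previous
  lemma, and the factorization is pulled back along the injective embedding of the
  coefficients.\<close>

lemma char_poly_symmetric_real_splits:
  fixes A :: "real mat"
  assumes A: "A \<in> carrier_mat n n" and sym: "transpose_mat A = A"
  obtains es where "char_poly A = (\<Prod>e\<leftarrow>es. [:- e, 1:])" "length es = n"
proof -
  let ?C = "map_mat complex_of_real A"
  have C: "?C \<in> carrier_mat n n" using A by simp
  obtain as where as: "char_poly ?C = (\<Prod>a\<leftarrow>as. [:- a, 1:])" "length as = n"
    using char_poly_factorized[OF C] by blast
  have "a \<in> \<real>" if "a \<in> set as" for a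
  proof (rule eigenvalue_symmetric_real[OF A sym])
    have "poly (char_poly ?C) a = 0"
      unfolding as(1) poly_prod_list prod_list_zero_iff using that by (force simp: image_iff)
    then show "eigenvalue ?C a" using eigenvalue_root_char_poly[OF C] by simp
  qed
  then have as': "as = map complex_of_real (map Re as)"
    by (simp add: map_idI)
  interpret h: map_poly_inj_idom_hom complex_of_real ..
  have "map_poly complex_of_real (char_poly A) = char_poly ?C"
    by (simp add: of_real_hom.char_poly_hom[OF A])
  also have "\<dots> = map_poly complex_of_real (\<Prod>e\<leftarrow>map Re as. [:- e, 1:])"
    unfolding as(1) by (subst as') (simp add: h.hom_prod_list o_def)
  finally have "char_poly A = (\<Prod>e\<leftarrow>map Re as. [:- e, 1:])"
    by (simp only: h.eq_iff)
  from that[OF this] show thesis using as(2) by simp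
qed

lemma sum_diag_square_symmetric:
  fixes A :: "'a::comm_semiring_1 mat"
  assumes A: "A \<in> carrier_mat n n" and sym: "transpose_mat A = A"
  shows "(\<Sum>i<n. (A * A) $$ (i, i)) = (\<Sum>i<n. \<Sum>j<n. (A $$ (i, j))\<^sup>2)"
proof -
  have "A $$ (j, i) = A $$ (i, j)" if "i < n" "j < n" for i j
    using arg_cong[OF sym, of "\<lambda>M. M $$ (i, j)"] that A by simp
  then show ?thesis
    using A by (auto simp: scalar_prod_def lessThan_atLeast0 power2_eq_square intro!: sum.cong)
qed

text \<open>A monic cubic without constant term, evaluated at a matrix. The polynomial needed later
  has the roots \<open>\<theta>\<close>, \<open>0\<close> and \<open>-n/2\<close>, hence this
  shape.\<close>

definition cubic :: "real \<Rightarrow> real \<Rightarrow> real mat \<Rightarrow> real mat" where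
  "cubic p q A = A * (A * A) + p \<cdot>\<^sub>m (A * A) + q \<cdot>\<^sub>m A"

lemma cubic_carrier [simp]: "A \<in> carrier_mat n n \<Longrightarrow> cubic p q A \<in> carrier_mat n n"
  by (auto simp: cubic_def)

lemma cubic_conjugate:
  assumes "P \<in> carrier_mat n n" "Q \<in> carrier_mat n n" "T \<in> carrier_mat n n" "Q * P = 1\<^sub>m n"
  shows "cubic p q (P * T * Q) = P * cubic p q T * Q"
proof -
  note c = assms(1-2)
  have T2: "T * T \<in> carrier_mat n n" and T3: "T * (T * T) \<in> carrier_mat n n"
    using assms(3) by simp_all
  have "cubic p q (P * T * Q) = P * (T * (T * T)) * Q + P * (p \<cdot>\<^sub>m (T * T)) * Q + P * (q \<cdot>\<^sub>m T) * Q"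
    unfolding cubic_def
    by (simp only: conjugate_mult[OF c assms(3) assms(3,4)] conjugate_mult[OF c assms(3) T2 assms(4)]
        conjugate_smult[OF c T2] conjugate_smult[OF c assms(3)])
  also have "\<dots> = P * (T * (T * T) + p \<cdot>\<^sub>m (T * T)) * Q + P * (q \<cdot>\<^sub>m T) * Q"
    using T2 T3 by (subst conjugate_add[OF c]) auto
  also have "\<dots> = P * cubic p q T * Q"
    unfolding cubic_def using T2 T3 assms(3) by (subst conjugate_add[OF c]) auto
  finally show ?thesis .
qed

lemma transpose_cubic:
  assumes A: "A \<in> carrier_mat n n" and sym: "transpose_mat A = A"
  shows "transpose_mat (cubic p q A) = cubic p q A"
proof -
  have smult_transpose: "transpose_mat (c \<cdot>\<^sub>m B) = c \<cdot>\<^sub>m transpose_mat B" for c and B :: "real mat"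
    by (rule eq_matI) auto
  have s2: "transpose_mat (A * A) = A * A"
    using transpose_mult[OF A A] sym by simp
  have s3: "transpose_mat (A * (A * A)) = A * (A * A)"
    using transpose_mult[OF A mult_carrier_mat[OF A A]] sym s2 A by (simp add: assoc_mult_mat[of _ n n _ n _ n])
  show ?thesis
    unfolding cubic_def using A s2 s3 sym
    by (simp add: transpose_add[of _ n n] smult_transpose)
qed

lemma cubic_upper_triangular:
  assumes T: "T \<in> carrier_mat n n" and ut: "upper_triangular T"
  shows "upper_triangular (cubic p q T)"
    and "i < n \<Longrightarrow> cubic p q T $$ (i, i) = T $$ (i, i) ^ 3 + p * (T $$ (i, i))\<^sup>2 + q * T $$ (i, i)"
proof -
  have ut2: "upper_triangular (T * T)" and ut3: "upper_triangular (T * (T * T))"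
    using upper_triangular_mult[OF T T ut ut] upper_triangular_mult[OF T mult_carrier_mat[OF T T] ut]
    by blast+
  show "upper_triangular (cubic p q T)"
    using ut ut2 ut3 T unfolding cubic_def upper_triangular_def by auto
  assume i: "i < n"
  have "(T * T) $$ (i, i) = (T $$ (i, i))\<^sup>2"
    using diag_mult_upper_triangular[OF T T ut ut i] by (simp add: power2_eq_square)
  moreover have "(T * (T * T)) $$ (i, i) = T $$ (i, i) ^ 3"
    using diag_mult_upper_triangular[OF T mult_carrier_mat[OF T T] ut ut2 i] calculation
    by (simp add: power2_eq_square power3_eq_cube)
  ultimately show "cubic p q T $$ (i, i) = T $$ (i, i) ^ 3 + p * (T $$ (i, i))\<^sup>2 + q * T $$ (i, i)"
    using i T unfolding cubic_def by simp
qed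

text \<open>Collects what the list of eigenvalues decides: the dimension, the sum of the squared
  entries, and which cubics annihilate the matrix. A Schur decomposition puts the eigenvalues on the
  diagonal of a similar triangular matrix \<open>T\<close>.\<close>

lemma symmetric_real_spectrum:
  fixes A :: "real mat"
  assumes A: "A \<in> carrier_mat n n" and sym: "transpose_mat A = A"
  obtains es where "char_poly A = (\<Prod>e\<leftarrow>es. [:- e, 1:])" "length es = n"
    "(\<Sum>e\<leftarrow>es. e\<^sup>2) = (\<Sum>i<n. \<Sum>j<n. (A $$ (i, j))\<^sup>2)"
    "\<forall>p q. cubic p q A = 0\<^sub>m n n \<longleftrightarrow> (\<forall>e\<in>set es. e ^ 3 + p * e\<^sup>2 + q * e = 0)"
proof -
  obtain es where es: "char_poly A = (\<Prod>e\<leftarrow>es. [:- e, 1:])" "length es = n"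
    using char_poly_symmetric_real_splits[OF A sym] .
  obtain T P Q where "schur_decomposition A es = (T, P, Q)"
    by (rule prod_cases3)
  from schur_decomposition[OF A es(1) this]
  have wit: "similar_mat_wit A T P Q" and ut: "upper_triangular T" and diag: "diag_mat T = es"
    by auto
  note w = similar_mat_witD2[OF A wit]
  have es_nth: "es ! i = T $$ (i, i)" if "i < n" for i
    using that w(5) by (simp add: diag[symmetric] diag_mat_def)
  have "(\<Sum>e\<leftarrow>es. e\<^sup>2) = (\<Sum>i<n. (es ! i)\<^sup>2)"
    by (simp add: sum_list_sum_nth es(2) lessThan_atLeast0)
  also have "\<dots> = (\<Sum>i<n. (T * T) $$ (i, i))"
    by (intro sum.cong refl)
      (simp add: es_nth diag_mult_upper_triangular[OF w(5) w(5) ut ut] power2_eq_square)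
  also have "\<dots> = (\<Sum>i<n. (A * A) $$ (i, i))"
    using sum_diag_conjugate[OF w(6) w(7) mult_carrier_mat[OF w(5) w(5)] w(2)]
      conjugate_mult[OF w(6) w(7) w(5) w(5) w(2)] w(3) by simp
  finally have sq: "(\<Sum>e\<leftarrow>es. e\<^sup>2) = (\<Sum>i<n. \<Sum>j<n. (A $$ (i, j))\<^sup>2)"
    using sum_diag_square_symmetric[OF A sym] by simp
  have "cubic p q A = 0\<^sub>m n n \<longleftrightarrow> (\<forall>e\<in>set es. e ^ 3 + p * e\<^sup>2 + q * e = 0)" for p q
  proof
    let ?S = "cubic p q T"
    have S: "?S \<in> carrier_mat n n" using w(5) by simp
    have AS: "cubic p q A = P * ?S * Q"
      using cubic_conjugate[OF w(6) w(7) w(5) w(2)] w(3) by simp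
    have ev: "?S $$ (i, i) = (es ! i) ^ 3 + p * (es ! i)\<^sup>2 + q * es ! i" if "i < n" for i
      using cubic_upper_triangular(2)[OF w(5) ut that] es_nth[OF that] by simp
    {
      assume z: "cubic p q A = 0\<^sub>m n n"
      \<comment> \<open>Conjugating back shows that the cubic vanishes at \<open>T\<close> as well,
        in particular on its diagonal.\<close>
      have "?S = (Q * P) * ?S * (Q * P)"
        using w(2) S by simp
      also have "\<dots> = Q * (P * ?S * Q) * P"
        using w(6,7) S by (simp add: assoc_mult_mat[of _ n n _ n _ n])
      also have "\<dots> = 0\<^sub>m n n"
        unfolding AS[symmetric] z using w(6,7) by simp
      finally have "?S = 0\<^sub>m n n" .
      then have "(es ! i) ^ 3 + p * (es ! i)\<^sup>2 + q * es ! i = 0" if "i < n" for i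
        using ev[OF that] that by simp
      then show "\<forall>e\<in>set es. e ^ 3 + p * e\<^sup>2 + q * e = 0"
        using es(2) by (auto simp: in_set_conv_nth)
    next
      assume "\<forall>e\<in>set es. e ^ 3 + p * e\<^sup>2 + q * e = 0"
      then have dz: "?S $$ (i, i) = 0" if "i < n" for i
        using ev[OF that] es(2) that by simp
      \<comment> \<open>The cubic of \<open>T\<close> is triangular with zero diagonal, so its
        square has trace zero. The similar matrix \<open>?M\<close> is symmetric, so this trace is
        the sum of its squared entries. No diagonalization of \<open>A\<close> is required.\<close>
      let ?M = "cubic p q A"
      have M: "?M \<in> carrier_mat n n" using A by simp
      have "(\<Sum>i<n. \<Sum>j<n. (?M $$ (i, j))\<^sup>2) = (\<Sum>i<n. (?M * ?M) $$ (i, i))"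
        using sum_diag_square_symmetric[OF M transpose_cubic[OF A sym]] by simp
      also have "\<dots> = (\<Sum>i<n. (?S * ?S) $$ (i, i))"
        using sum_diag_conjugate[OF w(6) w(7) mult_carrier_mat[OF S S] w(2)]
          conjugate_mult[OF w(6) w(7) S S w(2)] AS by simp
      also have "\<dots> = 0"
        by (rule sum.neutral)
          (simp add: dz diag_mult_upper_triangular[OF S S] cubic_upper_triangular(1)[OF w(5) ut])
      finally have "?M $$ (i, j) = 0" if "i < n" "j < n" for i j
        using that by (simp add: sum_nonneg_eq_0_iff sum_nonneg)
      then show "?M = 0\<^sub>m n n"
        using M by (intro eq_matI) auto
    }
  qed
  then have "\<forall>p q. cubic p q A = 0\<^sub>m n n \<longleftrightarrow> (\<forall>e\<in>set es. e ^ 3 + p * e\<^sup>2 + q * e = 0)"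
    by (intro allI)
  from that[OF es sq this] show thesis .
qed

section \<open>Distances in connected graphs\<close>

context pair_graph
begin

text \<open>Distances are minima over paths. Since cutting cycles out of a walk does not lengthen
  it, any walk bounds the distance from above.\<close>

lemma length_awalk_to_apath_le:
  assumes "awalk u p v"
  shows "length (awalk_to_apath p) \<le> length p"
  using assms
proof (induct rule: awalk_to_apath_induct)
  case (path p)
  then have "\<exists>u. distinct (awalk_verts u p)" by blast
  then show ?case by (subst awalk_to_apath.simps) simp
next
  case (decomp p q r s)
  then have "p = q @ r @ s"
    using awalk_cyc_decomp_has_prop[of u p v] by auto
  then show ?case using decomp step_awalk_to_apath[of u p v q r s] by simp
qed

lemma graph_dist_le_length:
  assumes "awalk u p v"
  shows "graph_dist G u v \<le> length p"
proof -
  have "graph_dist G u v \<le> length (awalk_to_apath p)"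
    unfolding graph_dist_def
    by (rule Least_le) (use apath_awalk_to_apath[OF assms] in blast)
  then show ?thesis using length_awalk_to_apath_le[OF assms] by simp
qed

lemma awalk_of_length_graph_dist:
  assumes "awalk u p v"
  obtains p' where "awalk u p' v" "length p' = graph_dist G u v"
proof -
  have "\<exists>p'. apath u p' v \<and> length p' = graph_dist G u v"
    unfolding graph_dist_def
    by (rule LeastI_ex) (use apath_awalk_to_apath[OF assms] in blast)
  then show thesis using that awalkI_apath by blast
qed

text \<open>Recognizes a function as the distance: \<open>arc\<close> makes it a lower bound for the
  length of every walk to \<open>w\<close>, and \<open>step\<close> allows a greedy descent along a
  walk of exactly that length.\<close>

lemma graph_dist_eqI:
  assumes zero: "\<And>u. u \<in> pverts G \<Longrightarrow> f u u = 0"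
    and arc: "\<And>u v w. (u, v) \<in> parcs G \<Longrightarrow> w \<in> pverts G \<Longrightarrow> f u w \<le> Suc (f v w)"
    and step: "\<And>u w. u \<in> pverts G \<Longrightarrow> w \<in> pverts G \<Longrightarrow> u \<noteq> w \<Longrightarrow>
      \<exists>v. (u, v) \<in> parcs G \<and> f u w = Suc (f v w)"
    and u: "u \<in> pverts G" and w: "w \<in> pverts G"
  shows "graph_dist G u w = f u w"
proof -
  have le: "f u w \<le> length p" if "awalk u p w" for u p
    using that
  proof (induct p arbitrary: u)
    case Nil
    then show ?case using zero by (auto simp: awalk_Nil_iff)
  next
    case (Cons e p)
    then have e: "(u, snd e) \<in> parcs G" "awalk (snd e) p w"
      by (cases e; auto simp: awalk_Cons_iff)+
    show ?case using arc[OF e(1) w] Cons(1)[OF e(2)] by simp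
  qed
  have "\<exists>p. awalk u p w \<and> length p = f u w" if "u \<in> pverts G" for u
    using that
  proof (induct "f u w" arbitrary: u)
    case 0
    \<comment> \<open>Here \<open>u = w\<close>, since \<open>step\<close> would otherwise make the
      value a successor.\<close>
    then show ?case using step[of u w] w by (auto simp: awalk_Nil_iff intro!: exI[of _ "[]"])
  next
    case (Suc n)
    then have "u \<noteq> w" using zero w by auto
    then obtain v where v: "(u, v) \<in> parcs G" "f u w = Suc (f v w)"
      using step Suc w by blast
    have "n = f v w" using Suc.hyps(2) v(2) by simp
    from Suc.hyps(1)[OF this in_arcsD2[OF v(1)]] obtain p where "awalk v p w" "length p = f v w"
      by blast
    then show ?case using v by (intro exI[of _ "(u, v) # p"]) (simp add: awalk_Cons_iff)
  qed
  then obtain p where p: "awalk u p w" "length p = f u w" using u by blast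
  obtain p' where p': "awalk u p' w" "length p' = graph_dist G u w"
    using awalk_of_length_graph_dist[OF p(1)] .
  show ?thesis using le[OF p'(1)] graph_dist_le_length[OF p(1)] p(2) p'(2) by simp
qed

lemma graph_dist_self: "u \<in> pverts G \<Longrightarrow> graph_dist G u u = 0"
  using graph_dist_le_length[of u "[]" u] by (simp add: awalk_Nil_iff)

lemma graph_dist_commute: "graph_dist G u v = graph_dist G v u"
proof -
  have "(\<exists>p. apath u p v \<and> length p = n) \<longleftrightarrow> (\<exists>p. apath v p u \<and> length p = n)" for n
  proof -
    have len: "length (rev_path p) = length p" for p :: "('a \<times> 'a) list"
      by (induct p) auto
    show ?thesis by (metis apath_rev_path len)
  qed
  then show ?thesis unfolding graph_dist_def by simp
qed

context
  assumes connected: "connected (with_proj G)"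
begin

lemma awalk_if_connected:
  assumes "u \<in> pverts G" "v \<in> pverts G"
  obtains p where "awalk u p v"
proof -
  have "strongly_connected (with_proj G)"
    using symmetric_connected_imp_strongly_connected connected sym_arcs by simp
  then have "u \<rightarrow>\<^sup>*\<^bsub>with_proj G\<^esub> v"
    using assms by (simp add: strongly_connected_def)
  then show thesis using that reachable_awalk by blast
qed

lemma graph_dist_eq_0_iff:
  assumes "u \<in> pverts G" "v \<in> pverts G"
  shows "graph_dist G u v = 0 \<longleftrightarrow> u = v"
proof
  assume z: "graph_dist G u v = 0"
  obtain p where "awalk u p v" using awalk_if_connected[OF assms] .
  then obtain p' where "awalk u p' v" "length p' = graph_dist G u v"
    using awalk_of_length_graph_dist by blast
  then show "u = v" using z by (simp add: awalk_Nil_iff)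
qed (use graph_dist_self assms in simp)

lemma graph_dist_arc_le:
  assumes "(u, v) \<in> parcs G" "w \<in> pverts G"
  shows "graph_dist G u w \<le> Suc (graph_dist G v w)"
proof -
  have v: "v \<in> pverts G" using assms in_arcsD2 by blast
  obtain p where "awalk v p w" using awalk_if_connected[OF v assms(2)] .
  then obtain p' where p': "awalk v p' w" "length p' = graph_dist G v w"
    using awalk_of_length_graph_dist by blast
  then have "awalk u ((u, v) # p') w" using assms by (simp add: awalk_Cons_iff)
  from graph_dist_le_length[OF this] show ?thesis using p' by simp
qed

text \<open>The arc is the first one of a shortest walk; \<open>graph_dist_arc_le\<close> excludes a
  drop by more than one.\<close>

lemma graph_dist_step:
  assumes "u \<in> pverts G" "w \<in> pverts G" "u \<noteq> w"
  obtains v where "(u, v) \<in> parcs G" "graph_dist G u w = Suc (graph_dist G v w)"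
proof -
  obtain p where "awalk u p w" using awalk_if_connected[OF assms(1,2)] .
  then obtain p where p: "awalk u p w" "length p = graph_dist G u w"
    using awalk_of_length_graph_dist by blast
  then obtain e p' where [simp]: "p = e # p'"
    using assms by (cases p) (auto simp: awalk_Nil_iff)
  have e: "(u, snd e) \<in> parcs G" "awalk (snd e) p' w"
    using p(1) by (cases e; auto simp: awalk_Cons_iff)+
  have "graph_dist G (snd e) w \<le> length p'" using graph_dist_le_length e(2) by simp
  then have "graph_dist G u w = Suc (graph_dist G (snd e) w)"
    using p(2) graph_dist_arc_le[OF e(1) assms(2)] by simp
  then show thesis using that e(1) by blast
qed

lemma graph_dist_arc:
  assumes "(u, v) \<in> parcs G"
  shows "graph_dist G u v = 1"
proof -
  have "u \<in> pverts G" "v \<in> pverts G" "u \<noteq> v"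
    using assms in_arcsD1 in_arcsD2 no_loops' by blast+
  then show ?thesis
    using graph_dist_arc_le[OF assms, of v] graph_dist_eq_0_iff graph_dist_self[of v] by force
qed

end

end

section \<open>The hypercube\<close>

definition hamming :: "'a list \<Rightarrow> 'a list \<Rightarrow> nat" where
  "hamming x y = card {i. i < length x \<and> x ! i \<noteq> y ! i}"

lemma pverts_hypercube: "pverts (hypercube d) = {x. set x \<subseteq> {0, 1} \<and> length x = d}"
  by (auto simp: hypercube_def)

lemma parcs_hypercube:
  "parcs (hypercube d) =
    {(x, y). x \<in> pverts (hypercube d) \<and> y \<in> pverts (hypercube d) \<and> hamming x y = 1}"
  by (auto simp: hypercube_def hamming_def Let_def)

lemma hamming_eq_0: "length x = length y \<Longrightarrow> hamming x y = 0 \<longleftrightarrow> x = y"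
  by (auto simp: hamming_def intro: nth_equalityI)

lemma hamming_commute: "length x = length y \<Longrightarrow> hamming x y = hamming y x"
  by (auto simp: hamming_def intro!: arg_cong[where f = card])

lemma hamming_triangle:
  assumes "length x = length y"
  shows "hamming x z \<le> hamming x y + hamming y z"
proof -
  have "hamming x z \<le> card ({i. i < length x \<and> x ! i \<noteq> y ! i} \<union> {i. i < length y \<and> y ! i \<noteq> z ! i})"
    unfolding hamming_def using assms by (intro card_mono) auto
  also have "\<dots> \<le> hamming x y + hamming y z"
    unfolding hamming_def by (rule card_Un_le)
  finally show ?thesis .
qed

lemma pair_graph_hypercube: "pair_graph (hypercube d)"
proof
  show fin: "finite (pverts (hypercube d))"
    unfolding pverts_hypercube by (rule finite_lists_length_eq) simp
  show "finite (parcs (hypercube d))"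
    by (rule finite_subset[OF _ finite_cartesian_product[OF fin fin]]) (auto simp: parcs_hypercube)
  show "symmetric (with_proj (hypercube d))"
    by (auto simp: symmetric_def parcs_hypercube pverts_hypercube hamming_commute intro!: symI)
qed (auto simp: parcs_hypercube hamming_def)

lemma card_pverts_hypercube: "card (pverts (hypercube d)) = 2 ^ d"
  unfolding pverts_hypercube by (subst card_lists_length_eq) (auto simp: numeral_2_eq_2)

text \<open>One coordinate in which \<open>x\<close> differs from \<open>y\<close> is overwritten by
  its value in \<open>y\<close>.\<close>

lemma hypercube_step:
  assumes x: "x \<in> pverts (hypercube d)" and y: "y \<in> pverts (hypercube d)" and "x \<noteq> y"
  shows "\<exists>z. (x, z) \<in> parcs (hypercube d) \<and> hamming x y = Suc (hamming z y)"
proof -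
  have len: "length x = d" "length y = d" using x y by (auto simp: pverts_hypercube)
  obtain i where i: "i < d" "x ! i \<noteq> y ! i" using assms(3) len by (metis nth_equalityI)
  define z where "z = x[i := y ! i]"
  have lz: "length z = d" using len by (simp add: z_def)
  have "y ! i \<in> {0, 1}" using y i len by (auto simp: pverts_hypercube subset_iff)
  then have z: "z \<in> pverts (hypercube d)"
    using x set_update_subset_insert[of x i "y ! i"] by (auto simp: pverts_hypercube z_def)
  have "{j. j < d \<and> x ! j \<noteq> z ! j} = {i}"
    using i len by (auto simp: z_def nth_list_update split: if_splits)
  then have "(x, z) \<in> parcs (hypercube d)"
    using x z len by (simp add: parcs_hypercube hamming_def)
  moreover have "{j. j < d \<and> x ! j \<noteq> y ! j} = insert i {j. j < d \<and> z ! j \<noteq> y ! j}"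
    using i len by (auto simp: z_def nth_list_update split: if_splits)
  then have "hamming x y = Suc (hamming z y)"
    using i len lz by (simp add: hamming_def) (subst card_insert_disjoint; simp add: z_def)
  ultimately show ?thesis by blast
qed

lemma graph_dist_hypercube:
  assumes x: "x \<in> pverts (hypercube d)" and y: "y \<in> pverts (hypercube d)"
  shows "graph_dist (hypercube d) x y = hamming x y"
proof (rule pair_graph.graph_dist_eqI[OF pair_graph_hypercube _ _ hypercube_step x y])
  fix u v w assume "(u, v) \<in> parcs (hypercube d)"
  then show "hamming u w \<le> Suc (hamming v w)"
    using hamming_triangle[of u v w] by (auto simp: parcs_hypercube pverts_hypercube)
qed (auto simp: hamming_eq_0)

section \<open>Sums over vertices determined by the distance spectrum\<close>

lemma proots_prod_linear:
  fixes es :: "'a::idom list"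
  shows "proots (\<Prod>e\<leftarrow>es. [:- e, 1:]) = mset es"
proof (induct es)
  case (Cons e es)
  have "(\<Prod>e\<leftarrow>es. [:- e, 1:]) \<noteq> 0"
    by (auto simp: prod_list_zero_iff)
  then have "proots ([:- e, 1:] * (\<Prod>e\<leftarrow>es. [:- e, 1:])) = {#e#} + mset es"
    using Cons by (subst proots_mult) auto
  then show ?case by (simp del: mult_pCons_left)
qed simp

lemma (in pair_graph) vertex_list:
  "distinct (vertex_list G)" "set (vertex_list G) = pverts G"
proof -
  have "\<exists>vs. distinct vs \<and> set vs = pverts G"
    using finite_distinct_list[OF pair_finite_verts] by blast
  then have "distinct (vertex_list G) \<and> set (vertex_list G) = pverts G"
    unfolding vertex_list_def by (rule someI_ex)
  then show "distinct (vertex_list G)" "set (vertex_list G) = pverts G" by auto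
qed

abbreviation real_dist :: "'a pair_pre_digraph \<Rightarrow> 'a \<Rightarrow> 'a \<Rightarrow> real" where
  "real_dist G u v \<equiv> real (graph_dist G u v)"

text \<open>The entries of \<open>cubic p q\<close> at the distance matrix, as sums over vertices:
  the arbitrary order chosen by \<open>vertex_list\<close> disappears from all later
  arguments.\<close>

definition distance_cubic :: "real \<Rightarrow> real \<Rightarrow> 'a pair_pre_digraph \<Rightarrow> 'a \<Rightarrow> 'a \<Rightarrow> real" where
  "distance_cubic p q G x y =
    (\<Sum>z\<in>pverts G. real_dist G x z * (\<Sum>w\<in>pverts G. real_dist G z w * real_dist G w y)) +
    p * (\<Sum>z\<in>pverts G. real_dist G x z * real_dist G z y) + q * real_dist G x y"

text \<open>Transfers \<open>symmetric_real_spectrum\<close> from indices to vertices along the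
  bijection given by the vertex list.\<close>

lemma (in pair_graph) distance_spectrum_eq:
  obtains es where "distance_spectrum G = mset es" "length es = card (pverts G)"
    "(\<Sum>e\<leftarrow>es. e\<^sup>2) = (\<Sum>x\<in>pverts G. \<Sum>y\<in>pverts G. (real_dist G x y)\<^sup>2)"
    "\<forall>p q. (\<forall>e\<in>set es. e ^ 3 + p * e\<^sup>2 + q * e = 0) \<longleftrightarrow>
      (\<forall>x\<in>pverts G. \<forall>y\<in>pverts G.
        distance_cubic p q G x y = 0)"
proof -
  define vs where "vs = vertex_list G"
  define n where "n = length vs"
  define A where "A = distance_matrix G"
  have bij: "bij_betw ((!) vs) {..<n} (pverts G)"
    using bij_betw_nth vertex_list unfolding vs_def n_def by blast
  have card: "card (pverts G) = n" using bij_betw_same_card[OF bij] by simp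
  have A: "A \<in> carrier_mat n n"
    by (simp add: A_def distance_matrix_def Let_def vs_def n_def)
  have Aij: "A $$ (i, j) = real_dist G (vs ! i) (vs ! j)" if "i < n" "j < n" for i j
    using that by (simp add: A_def distance_matrix_def Let_def vs_def n_def)
  have sym: "transpose_mat A = A"
    using A by (intro eq_matI) (auto simp: Aij graph_dist_commute)
  have sum_V: "(\<Sum>x\<in>pverts G. f x) = (\<Sum>i<n. f (vs ! i))" for f :: "'a \<Rightarrow> real"
    using sum.reindex_bij_betw[OF bij, of f] by simp
  have all_V: "(\<forall>x\<in>pverts G. P x) \<longleftrightarrow> (\<forall>i<n. P (vs ! i))" for P
    using bij_betw_imp_surj_on[OF bij] by (metis imageE imageI lessThan_iff)
  have A2: "(A * A) $$ (i, j) = (\<Sum>k<n. A $$ (i, k) * A $$ (k, j))" if "i < n" "j < n" for i j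
    using that A by (simp add: scalar_prod_def lessThan_atLeast0)
  have A3: "(A * (A * A)) $$ (i, j) = (\<Sum>k<n. A $$ (i, k) * (\<Sum>l<n. A $$ (k, l) * A $$ (l, j)))"
    if "i < n" "j < n" for i j
    using that A mult_carrier_mat[OF A A]
    by (simp add: scalar_prod_def lessThan_atLeast0 del: assoc_mult_mat)
  obtain es where es: "char_poly A = (\<Prod>e\<leftarrow>es. [:- e, 1:])" "length es = n"
    "(\<Sum>e\<leftarrow>es. e\<^sup>2) = (\<Sum>i<n. \<Sum>j<n. (A $$ (i, j))\<^sup>2)"
    "\<forall>p q. cubic p q A = 0\<^sub>m n n \<longleftrightarrow> (\<forall>e\<in>set es. e ^ 3 + p * e\<^sup>2 + q * e = 0)"
    using symmetric_real_spectrum[OF A sym] .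
  show thesis
  proof (rule that)
    show "distance_spectrum G = mset es"
      by (simp add: distance_spectrum_def es(1) proots_prod_linear flip: A_def)
    show "length es = card (pverts G)" by (simp add: card es(2))
    show "(\<Sum>e\<leftarrow>es. e\<^sup>2) = (\<Sum>x\<in>pverts G. \<Sum>y\<in>pverts G. (real_dist G x y)\<^sup>2)"
      unfolding es(3) sum_V by (intro sum.cong refl) (simp add: Aij)
    show "\<forall>p q. (\<forall>e\<in>set es. e ^ 3 + p * e\<^sup>2 + q * e = 0) \<longleftrightarrow>
      (\<forall>x\<in>pverts G. \<forall>y\<in>pverts G. distance_cubic p q G x y = 0)"
    proof (intro allI)
      fix p q
      have "cubic p q A $$ (i, j) =
          distance_cubic p q G (vs ! i) (vs ! j)" if "i < n" "j < n" for i j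
      proof -
        have "cubic p q A $$ (i, j) = (A * (A * A)) $$ (i, j) + p * (A * A) $$ (i, j) + q * A $$ (i, j)"
          using that A by (simp add: cubic_def)
        then show ?thesis
          unfolding A2[OF that] A3[OF that] distance_cubic_def sum_V by (simp add: Aij that)
      qed
      moreover have "cubic p q A = 0\<^sub>m n n \<longleftrightarrow> (\<forall>i<n. \<forall>j<n. cubic p q A $$ (i, j) = 0)"
      proof
        assume "\<forall>i<n. \<forall>j<n. cubic p q A $$ (i, j) = 0"
        then show "cubic p q A = 0\<^sub>m n n"
          using cubic_carrier[OF A, of p q] by (intro eq_matI) auto
      qed simp
      ultimately show "(\<forall>e\<in>set es. e ^ 3 + p * e\<^sup>2 + q * e = 0) \<longleftrightarrow>
        (\<forall>x\<in>pverts G. \<forall>y\<in>pverts G. distance_cubic p q G x y = 0)"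
        unfolding all_V using es(4) by simp
    qed
  qed
qed

text \<open>Both graphs have the same multiset of eigenvalues, and each of the three items depends
  on that multiset only.\<close>

lemma distance_cospectralD:
  assumes G: "pair_graph G" and H: "pair_graph H" and cosp: "distance_cospectral G H"
  shows "card (pverts G) = card (pverts H)"
    and "(\<Sum>x\<in>pverts G. \<Sum>y\<in>pverts G. (real_dist G x y)\<^sup>2) =
      (\<Sum>x\<in>pverts H. \<Sum>y\<in>pverts H. (real_dist H x y)\<^sup>2)"
    and "(\<And>x y. x \<in> pverts H \<Longrightarrow> y \<in> pverts H \<Longrightarrow>
        distance_cubic p q H x y = 0) \<Longrightarrow>
      x \<in> pverts G \<Longrightarrow> y \<in> pverts G \<Longrightarrow>
        distance_cubic p q G x y = 0"
proof -
  obtain es where es: "distance_spectrum G = mset es" "length es = card (pverts G)"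
    "(\<Sum>e\<leftarrow>es. e\<^sup>2) = (\<Sum>x\<in>pverts G. \<Sum>y\<in>pverts G. (real_dist G x y)\<^sup>2)"
    "\<forall>p q. (\<forall>e\<in>set es. e ^ 3 + p * e\<^sup>2 + q * e = 0) \<longleftrightarrow>
      (\<forall>x\<in>pverts G. \<forall>y\<in>pverts G.
        distance_cubic p q G x y = 0)"
    using pair_graph.distance_spectrum_eq[OF G] .
  obtain fs where fs: "distance_spectrum H = mset fs" "length fs = card (pverts H)"
    "(\<Sum>e\<leftarrow>fs. e\<^sup>2) = (\<Sum>x\<in>pverts H. \<Sum>y\<in>pverts H. (real_dist H x y)\<^sup>2)"
    "\<forall>p q. (\<forall>e\<in>set fs. e ^ 3 + p * e\<^sup>2 + q * e = 0) \<longleftrightarrow>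
      (\<forall>x\<in>pverts H. \<forall>y\<in>pverts H.
        distance_cubic p q H x y = 0)"
    using pair_graph.distance_spectrum_eq[OF H] .
  have m: "mset es = mset fs"
    using cosp es(1) fs(1) by (simp add: distance_cospectral_def)
  show "card (pverts G) = card (pverts H)"
    using mset_eq_length[OF m] es(2) fs(2) by simp
  have "(\<Sum>e\<leftarrow>es. e\<^sup>2) = (\<Sum>e\<leftarrow>fs. e\<^sup>2)"
    using m by (metis mset_map sum_mset_sum_list)
  then show "(\<Sum>x\<in>pverts G. \<Sum>y\<in>pverts G. (real_dist G x y)\<^sup>2) =
      (\<Sum>x\<in>pverts H. \<Sum>y\<in>pverts H. (real_dist H x y)\<^sup>2)"
    using es(3) fs(3) by simp
  have s: "set es = set fs" using m by (rule mset_eq_setD)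
  show "distance_cubic p q G x y = 0"
    if H0: "\<And>x y. x \<in> pverts H \<Longrightarrow> y \<in> pverts H \<Longrightarrow>
        distance_cubic p q H x y = 0"
      and x: "x \<in> pverts G" and y: "y \<in> pverts G"
  proof -
    have "\<forall>e\<in>set es. e ^ 3 + p * e\<^sup>2 + q * e = 0"
      unfolding s using fs(4) H0 by blast
    then show ?thesis using es(4) x y by blast
  qed
qed

section \<open>Distance sums in the hypercube\<close>

text \<open>On the cube this is the character \<open>(-1) ^ (x ! i)\<close>. Distances become inner
  products of sign vectors, and the characters are orthogonal.\<close>

definition sgn_coord :: "nat \<Rightarrow> nat list \<Rightarrow> real" where
  "sgn_coord i x = (if x ! i = 0 then 1 else -1)"

lemma sgn_coord_square: "sgn_coord i x * sgn_coord i x = 1"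
  by (simp add: sgn_coord_def)

lemma pverts_hypercubeD:
  assumes "z \<in> pverts (hypercube d)"
  shows "length z = d" and "i < d \<Longrightarrow> z ! i = 0 \<or> z ! i = 1"
proof -
  show "length z = d" using assms by (simp add: pverts_hypercube)
  then show "z ! i = 0 \<or> z ! i = 1" if "i < d"
    using assms nth_mem[of i z] that unfolding pverts_hypercube by blast
qed

text \<open>A product of signs is 1 where the lists agree and -1 where they differ, so the sum of
  products is \<open>d\<close> minus twice the Hamming distance.\<close>

lemma real_hamming_eq:
  assumes "x \<in> pverts (hypercube d)" "y \<in> pverts (hypercube d)"
  shows "real (hamming x y) = (real d - (\<Sum>i<d. sgn_coord i x * sgn_coord i y)) / 2"
proof -
  note bits = pverts_hypercubeD(2)[OF assms(1)] pverts_hypercubeD(2)[OF assms(2)]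
  have "(\<Sum>i<d. sgn_coord i x * sgn_coord i y) = (\<Sum>i<d. 1 - 2 * of_bool (x ! i \<noteq> y ! i))"
  proof (rule sum.cong[OF refl])
    fix i assume "i \<in> {..<d}"
    then show "sgn_coord i x * sgn_coord i y = 1 - 2 * of_bool (x ! i \<noteq> y ! i)"
      using bits[of i] by (auto simp: sgn_coord_def)
  qed
  also have "\<dots> = real d - 2 * (\<Sum>i<d. of_bool (x ! i \<noteq> y ! i))"
    by (simp add: sum_subtractf sum_distrib_left)
  also have "(\<Sum>i<d. of_bool (x ! i \<noteq> y ! i)) = real (card {i. i < d \<and> x ! i \<noteq> y ! i})"
    by (subst sum_of_bool_eq) (auto intro!: arg_cong[where f = card])
  finally show ?thesis using pverts_hypercubeD(1)[OF assms(1)] by (simp add: hamming_def)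
qed

text \<open>Flipping one coordinate is an involution of the cube, so the sum equals its own
  negative.\<close>

lemma sum_hypercube_flip:
  fixes f :: "nat list \<Rightarrow> real"
  assumes i: "i < d"
    and flip: "\<And>z. z \<in> pverts (hypercube d) \<Longrightarrow> f (z[i := 1 - z ! i]) = - f z"
  shows "(\<Sum>z\<in>pverts (hypercube d). f z) = 0"
proof -
  let ?V = "pverts (hypercube d)" and ?g = "\<lambda>z::nat list. z[i := 1 - z ! i]"
  have g: "?g z \<in> ?V" "?g (?g z) = z" if "z \<in> ?V" for z
  proof -
    note b = pverts_hypercubeD(2)[OF that i]
    show "?g z \<in> ?V"
      using that b set_update_subset_insert[of z i "1 - z ! i"] by (auto simp: pverts_hypercube)
    show "?g (?g z) = z"
      using that b i by (auto simp: pverts_hypercube list_update_same_conv)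
  qed
  have "(\<Sum>z\<in>?V. f z) = (\<Sum>z\<in>?V. f (?g z))"
    by (rule sum.reindex_bij_witness[of _ ?g ?g]) (use g in auto)
  also have "\<dots> = (\<Sum>z\<in>?V. - f z)"
    by (rule sum.cong[OF refl flip])
  finally show ?thesis by (simp add: sum_negf)
qed

lemma sum_sgn_coord:
  assumes "i < d"
  shows "(\<Sum>z\<in>pverts (hypercube d). sgn_coord i z) = 0"
proof (rule sum_hypercube_flip[OF assms])
  fix z assume "z \<in> pverts (hypercube d)"
  from pverts_hypercubeD[OF this] assms have "length z = d" "z ! i = 0 \<or> z ! i = 1" by simp_all
  then show "sgn_coord i (z[i := 1 - z ! i]) = - sgn_coord i z"
    using assms by (auto simp: sgn_coord_def)
qed

lemma sum_sgn_coord_mult: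
  assumes "i < d" "j < d"
  shows "(\<Sum>z\<in>pverts (hypercube d). sgn_coord i z * sgn_coord j z) = (if i = j then 2 ^ d else 0)"
proof (cases "i = j")
  case True
  then show ?thesis by (simp add: sgn_coord_square card_pverts_hypercube)
next
  case False
  have "(\<Sum>z\<in>pverts (hypercube d). sgn_coord i z * sgn_coord j z) = 0"
  proof (rule sum_hypercube_flip[OF assms(1)])
    fix z assume "z \<in> pverts (hypercube d)"
    from pverts_hypercubeD[OF this] assms have "length z = d" "z ! i = 0 \<or> z ! i = 1" by simp_all
    then show "sgn_coord i (z[i := 1 - z ! i]) * sgn_coord j (z[i := 1 - z ! i]) =
        - (sgn_coord i z * sgn_coord j z)"
      using False assms by (auto simp: sgn_coord_def)
  qed
  then show ?thesis using False by simp
qed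

lemma sum_sgn_coord_combination:
  "(\<Sum>z\<in>pverts (hypercube d). \<Sum>i<d. a i * sgn_coord i z) = 0"
proof -
  have "(\<Sum>z\<in>pverts (hypercube d). \<Sum>i<d. a i * sgn_coord i z) =
      (\<Sum>i<d. a i * (\<Sum>z\<in>pverts (hypercube d). sgn_coord i z))"
    unfolding sum_distrib_left by (rule sum.swap)
  then show ?thesis by (simp add: sum_sgn_coord)
qed

text \<open>Parseval's identity: the coordinate signs are orthogonal and each has squared norm
  \<open>2 ^ d\<close>.\<close>

lemma sum_sgn_coord_combination_mult:
  "(\<Sum>z\<in>pverts (hypercube d). (\<Sum>i<d. a i * sgn_coord i z) * (\<Sum>j<d. b j * sgn_coord j z)) =
    2 ^ d * (\<Sum>i<d. a i * b i)"
proof -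
  let ?V = "pverts (hypercube d)" and ?s = sgn_coord
  have "(\<Sum>z\<in>?V. (\<Sum>i<d. a i * ?s i z) * (\<Sum>j<d. b j * ?s j z)) =
      (\<Sum>z\<in>?V. \<Sum>i<d. \<Sum>j<d. a i * b j * (?s i z * ?s j z))"
    unfolding sum_product by (intro sum.cong refl) (simp add: mult_ac)
  also have "\<dots> = (\<Sum>i<d. \<Sum>z\<in>?V. \<Sum>j<d. a i * b j * (?s i z * ?s j z))"
    by (rule sum.swap)
  also have "\<dots> = (\<Sum>i<d. \<Sum>j<d. \<Sum>z\<in>?V. a i * b j * (?s i z * ?s j z))"
    by (rule sum.cong[OF refl]) (rule sum.swap)
  also have "\<dots> = (\<Sum>i<d. \<Sum>j<d. if i = j then 2 ^ d * (a i * b i) else 0)"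
    by (intro sum.cong refl) (simp add: sum_sgn_coord_mult flip: sum_distrib_left)
  also have "\<dots> = 2 ^ d * (\<Sum>i<d. a i * b i)"
    by (simp add: sum_distrib_left)
  finally show ?thesis .
qed

lemma graph_dist_hypercube_eq:
  assumes "x \<in> pverts (hypercube d)" "y \<in> pverts (hypercube d)"
  shows "real_dist (hypercube d) x y = (real d - (\<Sum>i<d. sgn_coord i x * sgn_coord i y)) / 2"
  unfolding graph_dist_hypercube[OF assms] by (rule real_hamming_eq[OF assms])

lemma sum_graph_dist_hypercube:
  assumes x: "x \<in> pverts (hypercube d)"
  shows "(\<Sum>z\<in>pverts (hypercube d). real_dist (hypercube d) x z) = 2 ^ d * real d / 2"
proof -
  let ?V = "pverts (hypercube d)"
  have "(\<Sum>z\<in>?V. real_dist (hypercube d) x z) =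
      (\<Sum>z\<in>?V. (real d - (\<Sum>i<d. sgn_coord i x * sgn_coord i z)) / 2)"
    by (intro sum.cong refl graph_dist_hypercube_eq x)
  also have "\<dots> = 2 ^ d * real d / 2"
    by (simp add: sum_subtractf sum_sgn_coord_combination card_pverts_hypercube
        flip: sum_divide_distrib)
  finally show ?thesis .
qed

text \<open>The entries of \<open>D\<^sup>2 + (n/2) D = c J\<close> for the cube. After expanding
  both distances in signs, the linear terms sum to zero and Parseval's identity evaluates the
  product.\<close>

lemma sum_graph_dist_mult_hypercube:
  assumes x: "x \<in> pverts (hypercube d)" and y: "y \<in> pverts (hypercube d)"
  shows "(\<Sum>z\<in>pverts (hypercube d). real_dist (hypercube d) x z * real_dist (hypercube d) z y) =
    2 ^ d * real d * (real d + 1) / 4 - 2 ^ d / 2 * real_dist (hypercube d) x y"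
proof -
  let ?V = "pverts (hypercube d)" and ?p = "\<lambda>x z. \<Sum>i<d. sgn_coord i x * sgn_coord i z"
  have "(\<Sum>z\<in>?V. real_dist (hypercube d) x z * real_dist (hypercube d) z y) =
      (\<Sum>z\<in>?V. (real d ^ 2 - d * ?p x z - d * ?p y z + ?p x z * ?p y z) / 4)"
  proof (rule sum.cong[OF refl])
    fix z assume z: "z \<in> ?V"
    have "?p z y = ?p y z" by (simp add: mult.commute)
    then show "real_dist (hypercube d) x z * real_dist (hypercube d) z y =
        (real d ^ 2 - d * ?p x z - d * ?p y z + ?p x z * ?p y z) / 4"
      unfolding graph_dist_hypercube_eq[OF x z] graph_dist_hypercube_eq[OF z y]
      by (simp add: field_simps power2_eq_square)
  qed
  also have "\<dots> = (2 ^ d * real d ^ 2 - d * (\<Sum>z\<in>?V. ?p x z) - d * (\<Sum>z\<in>?V. ?p y z)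
      + (\<Sum>z\<in>?V. ?p x z * ?p y z)) / 4"
    unfolding sum_divide_distrib[symmetric] sum.distrib sum_subtractf sum_distrib_left[symmetric]
    by (simp add: card_pverts_hypercube)
  also have "\<dots> = (2 ^ d * real d ^ 2 + 2 ^ d * ?p x y) / 4"
    by (simp add: sum_sgn_coord_combination sum_sgn_coord_combination_mult)
  also have "?p x y = real d - 2 * real_dist (hypercube d) x y"
    using graph_dist_hypercube_eq[OF x y] by simp
  finally show ?thesis by (simp add: field_simps power2_eq_square)
qed

lemma sum_graph_dist_square_hypercube:
  "(\<Sum>x\<in>pverts (hypercube d). \<Sum>y\<in>pverts (hypercube d). (real_dist (hypercube d) x y)\<^sup>2) =
    2 ^ d * (2 ^ d * real d * (real d + 1) / 4)"
proof -
  interpret pair_graph "hypercube d" by (rule pair_graph_hypercube)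
  have "(\<Sum>y\<in>pverts (hypercube d). (real_dist (hypercube d) x y)\<^sup>2) = 2 ^ d * real d * (real d + 1) / 4"
    if "x \<in> pverts (hypercube d)" for x
  proof -
    have "(\<Sum>y\<in>pverts (hypercube d). (real_dist (hypercube d) x y)\<^sup>2) =
        (\<Sum>y\<in>pverts (hypercube d). real_dist (hypercube d) x y * real_dist (hypercube d) y x)"
      by (intro sum.cong refl) (metis graph_dist_commute power2_eq_square)
    then show ?thesis
      unfolding sum_graph_dist_mult_hypercube[OF that that] by (simp add: graph_dist_self[OF that])
  qed
  then have "(\<Sum>x\<in>pverts (hypercube d). \<Sum>y\<in>pverts (hypercube d). (real_dist (hypercube d) x y)\<^sup>2) =
      (\<Sum>x\<in>pverts (hypercube d). 2 ^ d * real d * (real d + 1) / 4)"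
    by (rule sum.cong[OF refl])
  then show ?thesis by (simp add: card_pverts_hypercube)
qed

text \<open>The coefficients are those of \<open>X (X - \<theta>) (X + n/2)\<close> with
  \<open>n = 2 ^ d\<close> and \<open>\<theta> = n d / 2\<close>. It vanishes at \<open>D\<close>
  because \<open>D\<^sup>2 + (n/2) D\<close> is \<open>c J\<close> and the row sums are
  \<open>\<theta>\<close>, so that \<open>D - \<theta>\<close> annihilates it.\<close>

lemma distance_cubic_hypercube:
  assumes x: "x \<in> pverts (hypercube d)" and y: "y \<in> pverts (hypercube d)"
  shows "distance_cubic (2 ^ d / 2 - 2 ^ d * real d / 2) (- (2 ^ d * real d / 2 * (2 ^ d / 2))) (hypercube d) x y = 0"
proof -
  let ?V = "pverts (hypercube d)" and ?D = "real_dist (hypercube d)"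
  define c where "c = 2 ^ d * real d * (real d + 1) / 4"
  define S where "S = (\<Sum>z\<in>?V. ?D x z * ?D z y)"
  have "(\<Sum>z\<in>?V. ?D x z * (\<Sum>w\<in>?V. ?D z w * ?D w y)) = (\<Sum>z\<in>?V. ?D x z * (c - 2 ^ d / 2 * ?D z y))"
    by (intro sum.cong refl arg_cong2[where f = "(*)"])
      (simp add: sum_graph_dist_mult_hypercube[OF _ y] c_def)
  also have "\<dots> = (\<Sum>z\<in>?V. c * ?D x z - 2 ^ d / 2 * (?D x z * ?D z y))"
    by (intro sum.cong refl) (simp add: algebra_simps)
  also have "\<dots> = c * (\<Sum>z\<in>?V. ?D x z) - 2 ^ d / 2 * S"
    unfolding sum_subtractf S_def by (simp only: sum_distrib_left)
  finally have "distance_cubic (2 ^ d / 2 - 2 ^ d * real d / 2) (- (2 ^ d * real d / 2 * (2 ^ d / 2))) (hypercube d) x y =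
      c * (2 ^ d * real d / 2) - 2 ^ d / 2 * S + (2 ^ d / 2 - 2 ^ d * real d / 2) * S
      - 2 ^ d * real d / 2 * (2 ^ d / 2) * ?D x y"
    unfolding distance_cubic_def sum_graph_dist_hypercube[OF x] S_def by simp
  moreover have "S = c - 2 ^ d / 2 * ?D x y"
    unfolding S_def c_def by (rule sum_graph_dist_mult_hypercube[OF x y])
  ultimately show ?thesis by (simp add: algebra_simps)
qed

section \<open>Graphs cospectral with the hypercube\<close>

text \<open>The square sum of the entries of \<open>B\<close> attains the Cauchy--Schwarz bound, so each entry does.\<close>

lemma rank_one_if_idempotent:
  fixes B :: "'a \<Rightarrow> 'a \<Rightarrow> real"
  assumes fin: "finite V" and "0 < l"
    and sym: "\<And>x y. x \<in> V \<Longrightarrow> y \<in> V \<Longrightarrow> B x y = B y x"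
    and idem: "\<And>x y. x \<in> V \<Longrightarrow> y \<in> V \<Longrightarrow> (\<Sum>z\<in>V. B x z * B z y) = l * B x y"
    and trace: "(\<Sum>x\<in>V. B x x) = l"
    and x: "x \<in> V" and y: "y \<in> V"
  shows "(B x y)\<^sup>2 = B x x * B y y"
proof -
  have row: "(\<Sum>z\<in>V. (B x z)\<^sup>2) = l * B x x" if "x \<in> V" for x
    unfolding idem[OF that that, symmetric]
    by (intro sum.cong refl) (metis power2_eq_square sym that)
  \<comment> \<open>Cauchy-Schwarz for two rows of \<open>B\<close>, whose norms and inner product
    are again entries of \<open>B\<close> up to the factor \<open>l\<close>.\<close>
  have le: "(B x y)\<^sup>2 \<le> B x x * B y y" if "x \<in> V" "y \<in> V" for x y
  proof -
    have "(\<Sum>z\<in>V. B x z * B y z) = l * B x y"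
      unfolding idem[OF that, symmetric] by (intro sum.cong refl) (metis sym that(2))
    then have "(l * B x y)\<^sup>2 \<le> (l * B x x) * (l * B y y)"
      using Cauchy_Schwarz_ineq_sum[of "\<lambda>z. B x z" "\<lambda>z. B y z" V] row that by simp
    then have "l\<^sup>2 * (B x y)\<^sup>2 \<le> l\<^sup>2 * (B x x * B y y)"
      by (simp add: power_mult_distrib power2_eq_square mult_ac)
    then show ?thesis using \<open>0 < l\<close> by simp
  qed
  \<comment> \<open>The nonnegative gaps sum to zero, because the trace is equal to
    \<open>l\<close>.\<close>
  have "(\<Sum>x\<in>V. \<Sum>y\<in>V. B x x * B y y - (B x y)\<^sup>2) = (\<Sum>x\<in>V. B x x * l - l * B x x)"
    by (intro sum.cong refl) (simp add: sum_subtractf row trace flip: sum_distrib_left)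
  also have "\<dots> = 0" by simp
  finally have "(\<Sum>x\<in>V. \<Sum>y\<in>V. B x x * B y y - (B x y)\<^sup>2) = 0" .
  moreover have "(\<Sum>y\<in>V. B x x * B y y - (B x y)\<^sup>2) \<ge> 0" if "x \<in> V" for x
    using le that by (simp add: sum_nonneg)
  ultimately have "(\<Sum>y\<in>V. B x x * B y y - (B x y)\<^sup>2) = 0"
    using sum_nonneg_eq_0_iff[OF fin, of "\<lambda>x. \<Sum>y\<in>V. B x x * B y y - (B x y)\<^sup>2"] x by blast
  then have "B x x * B y y - (B x y)\<^sup>2 = 0"
    using sum_nonneg_eq_0_iff[OF fin, of "\<lambda>y. B x x * B y y - (B x y)\<^sup>2"] le x y by simp
  then show ?thesis by simp
qed

text \<open>The spectrum enters only through the last three assumptions, with the values computed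
  for the cube.\<close>

locale cube_cospectral = pair_graph G for G :: "'a pair_pre_digraph" +
  fixes d :: nat
  assumes d_pos: "1 \<le> d"
    and connected_G: "connected (with_proj G)"
    and card_G: "card (pverts G) = 2 ^ d"
    and sum_squares: "(\<Sum>x\<in>pverts G. \<Sum>y\<in>pverts G. (real_dist G x y)\<^sup>2) =
      2 ^ d * (2 ^ d * real d * (real d + 1) / 4)"
    and cubic_G: "\<And>x y. x \<in> pverts G \<Longrightarrow> y \<in> pverts G \<Longrightarrow>
      distance_cubic (2 ^ d / 2 - 2 ^ d * real d / 2) (- (2 ^ d * real d / 2 * (2 ^ d / 2))) G x y = 0"
begin

section \<open>The matrix \<open>B\<close> and its rank\<close>

abbreviation "V \<equiv> pverts G"

abbreviation D :: "'a \<Rightarrow> 'a \<Rightarrow> real" where "D \<equiv> real_dist G"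

definition B :: "'a \<Rightarrow> 'a \<Rightarrow> real" where
  "B x y = (\<Sum>z\<in>V. D x z * D z y) + 2 ^ d / 2 * D x y"

definition n :: real where "n = 2 ^ d"

lemma n_pos: "0 < n" by (simp add: n_def)

lemma D_commute: "D x y = D y x" by (simp add: graph_dist_commute)

lemma D_self: "x \<in> V \<Longrightarrow> D x x = 0" by (simp add: graph_dist_self)

lemma D_arc: "(x, y) \<in> parcs G \<Longrightarrow> D x y = 1"
  using graph_dist_arc[OF connected_G] by simp

text \<open>The cubic relation reads \<open>(D - \<theta>) B = 0\<close> with
  \<open>\<theta> = n d / 2\<close>, since \<open>B = D (D + n/2)\<close>.\<close>

lemma sum_D_B:
  assumes "x \<in> V" "y \<in> V"
  shows "(\<Sum>z\<in>V. D x z * B z y) = n * d / 2 * B x y"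
proof -
  have "(\<Sum>z\<in>V. D x z * B z y) =
      (\<Sum>z\<in>V. D x z * (\<Sum>w\<in>V. D z w * D w y) + n / 2 * (D x z * D z y))"
    unfolding B_def n_def by (intro sum.cong refl) (simp add: algebra_simps)
  also have "\<dots> = (\<Sum>z\<in>V. D x z * (\<Sum>w\<in>V. D z w * D w y)) + n / 2 * (\<Sum>z\<in>V. D x z * D z y)"
    by (simp only: sum.distrib sum_distrib_left)
  finally show ?thesis
    using cubic_G[OF assms] unfolding distance_cubic_def B_def n_def by (simp add: algebra_simps)
qed

text \<open>Applying \<open>D B = \<theta> B\<close> twice gives the factor
  \<open>\<theta>\<^sup>2 + (n/2) \<theta>\<close>, which is the constant stated.\<close>

lemma sum_B_B:
  assumes x: "x \<in> V" and y: "y \<in> V"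
  shows "(\<Sum>z\<in>V. B x z * B z y) = n\<^sup>2 * d * (d + 1) / 4 * B x y"
proof -
  have "(\<Sum>z\<in>V. B x z * B z y) =
      (\<Sum>z\<in>V. (\<Sum>w\<in>V. D x w * D w z * B z y) + n / 2 * (D x z * B z y))"
    by (intro sum.cong refl) (simp only: B_def[of x] n_def distrib_right sum_distrib_right mult.assoc)
  also have "\<dots> = (\<Sum>w\<in>V. D x w * (\<Sum>z\<in>V. D w z * B z y)) + n / 2 * (\<Sum>z\<in>V. D x z * B z y)"
    unfolding sum.distrib by (subst sum.swap) (simp add: sum_distrib_left mult.assoc)
  also have "(\<Sum>w\<in>V. D x w * (\<Sum>z\<in>V. D w z * B z y)) = (\<Sum>w\<in>V. n * d / 2 * (D x w * B w y))"
    by (intro sum.cong refl) (simp add: sum_D_B y)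
  also have "\<dots> = n * d / 2 * (\<Sum>w\<in>V. D x w * B w y)"
    by (rule sum_distrib_left[symmetric])
  finally show ?thesis
    unfolding sum_D_B[OF x y] by (simp add: algebra_simps power2_eq_square)
qed

lemma B_diag: "x \<in> V \<Longrightarrow> B x x = (\<Sum>z\<in>V. (D x z)\<^sup>2)"
  unfolding B_def by (simp add: graph_dist_self power2_eq_square graph_dist_commute cong: sum.cong)

lemma B_nonneg: "0 \<le> B x y"
  by (simp add: B_def sum_nonneg)

text \<open>The trace of \<open>B\<close> is the sum of the squared distances and equals the factor
  in \<open>sum_B_B\<close>. As the entries of \<open>B\<close> are nonnegative, square roots can be
  taken without a sign.\<close>

lemma B_rank_one:
  assumes "x \<in> V" "y \<in> V"
  shows "B x y = sqrt (B x x) * sqrt (B y y)"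
proof -
  have "(B x y)\<^sup>2 = B x x * B y y"
  proof (rule rank_one_if_idempotent[OF pair_finite_verts _ _ sum_B_B _ assms])
    show "0 < n\<^sup>2 * d * (d + 1) / 4" using n_pos d_pos by simp
    show "B x y = B y x" for x y
      unfolding B_def by (simp add: graph_dist_commute mult.commute)
    show "(\<Sum>x\<in>V. B x x) = n\<^sup>2 * d * (d + 1) / 4"
      using sum_squares by (simp add: B_diag n_def power2_eq_square add.commute)
  qed
  then have "sqrt ((B x y)\<^sup>2) = sqrt (B x x * B y y)" by simp
  then show ?thesis using B_nonneg by (simp add: real_sqrt_mult)
qed

lemma abs_D_diff_le:
  assumes "(x, y) \<in> parcs G" "z \<in> V"
  shows "\<bar>D x z - D y z\<bar> \<le> 1"
  using graph_dist_arc_le[OF connected_G assms] graph_dist_arc_le[OF connected_G arcs_symmetric[OF assms(1)] assms(2)]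
  by linarith

lemma sum_1: "(\<Sum>z\<in>V. 1) = n"
  by (simp add: card_G n_def)

text \<open>
  For adjacent \<open>x\<close> and \<open>y\<close> the rows of the distance matrix differ by at most one in every entry, while
  the rank one condition makes the sum of the squared differences at least the number of vertices.
\<close>

lemma
  assumes xy: "(x, y) \<in> parcs G"
  shows B_diag_arc: "B x x = B y y"
    and D_diff_arc: "z \<in> V \<Longrightarrow> (D x z - D y z)\<^sup>2 = 1"
proof -
  have x: "x \<in> V" and y: "y \<in> V" using xy in_arcsD1 in_arcsD2 by blast+
  have "(\<Sum>z\<in>V. (D x z - D y z)\<^sup>2) = (\<Sum>z\<in>V. (D x z)\<^sup>2 + (D y z)\<^sup>2 - 2 * (D x z * D z y))"
    by (intro sum.cong refl) (metis power2_diff D_commute mult.assoc)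
  also have "\<dots> = B x x + B y y - 2 * (\<Sum>z\<in>V. D x z * D z y)"
    by (simp add: sum.distrib sum_subtractf sum_distrib_left B_diag x y)
  \<comment> \<open>Adjacency enters here: \<open>D x y = 1\<close> contributes the
    \<open>n / 2\<close>, which becomes the lower bound \<open>n\<close> after completing the
    square.\<close>
  also have "(\<Sum>z\<in>V. D x z * D z y) = sqrt (B x x) * sqrt (B y y) - n / 2"
    using B_rank_one[OF x y] D_arc[OF xy] by (simp add: B_def n_def)
  finally have s: "(\<Sum>z\<in>V. (D x z - D y z)\<^sup>2) = (sqrt (B x x) - sqrt (B y y))\<^sup>2 + n"
    using B_nonneg by (simp add: power2_diff algebra_simps)
  have le: "(D x z - D y z)\<^sup>2 \<le> 1" if "z \<in> V" for z
    using abs_D_diff_le[OF xy that] by (simp add: abs_square_le_1)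
  have "(\<Sum>z\<in>V. (D x z - D y z)\<^sup>2) \<le> (\<Sum>z\<in>V. 1)"
    by (intro sum_mono le)
  then have "(sqrt (B x x) - sqrt (B y y))\<^sup>2 = 0"
    unfolding s sum_1 by simp
  then show "B x x = B y y" using B_nonneg by simp
  have "(\<Sum>z\<in>V. 1 - (D x z - D y z)\<^sup>2) = 0"
    unfolding sum_subtractf s sum_1 using \<open>(sqrt (B x x) - sqrt (B y y))\<^sup>2 = 0\<close> by simp
  then have "\<forall>z\<in>V. 1 - (D x z - D y z)\<^sup>2 = 0"
    using le pair_finite_verts by (subst (asm) sum_nonneg_eq_0_iff) auto
  then show "(D x z - D y z)\<^sup>2 = 1" if "z \<in> V" using that by simp
qed

text \<open>Connectedness spreads \<open>B_diag_arc\<close> along a shortest walk to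
  \<open>y\<close>.\<close>

lemma B_diag_const:
  assumes "x \<in> V" "y \<in> V"
  shows "B x x = B y y"
  using assms(1)
proof (induct "graph_dist G x y" arbitrary: x)
  case 0
  then show ?case using graph_dist_eq_0_iff[OF connected_G _ assms(2)] by simp
next
  case (Suc k)
  then have "x \<noteq> y" using graph_dist_self by force
  then obtain v where v: "(x, v) \<in> parcs G" "graph_dist G x y = Suc (graph_dist G v y)"
    using graph_dist_step[OF connected_G Suc.prems assms(2)] by blast
  have "k = graph_dist G v y" using v(2) Suc.hyps(2) by simp
  from Suc.hyps(1)[OF this in_arcsD2[OF v(1)]] show ?case using B_diag_arc[OF v(1)] by simp
qed

text \<open>The known trace is shared equally by the diagonal entries, and rank one then fixes all
  others.\<close>

lemma B_const:
  assumes x: "x \<in> V" and y: "y \<in> V"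
  shows "B x y = n * d * (d + 1) / 4"
proof -
  have "(\<Sum>z\<in>V. B z z) = n * (n * d * (d + 1) / 4)"
    using sum_squares by (simp add: B_diag n_def)
  moreover have "(\<Sum>z\<in>V. B z z) = (\<Sum>z\<in>V. B x x)"
    by (intro sum.cong refl B_diag_const x)
  ultimately have "n * B x x = n * (n * d * (d + 1) / 4)"
    by (simp add: card_G n_def)
  then have "B x x = n * d * (d + 1) / 4" using n_pos by simp
  then show ?thesis
    using B_rank_one[OF x y] B_diag_const[OF x y] B_nonneg[of x x] by simp
qed

text \<open>In \<open>D B = \<theta> B\<close> the matrix \<open>B\<close> is now a constant, which
  is nonzero as \<open>d\<close> is positive, so it cancels.\<close>

lemma sum_D:
  assumes "x \<in> V"
  shows "(\<Sum>z\<in>V. D x z) = n * d / 2"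
proof -
  let ?c = "n * d * (d + 1) / 4"
  have "(\<Sum>z\<in>V. D x z) * ?c = (\<Sum>z\<in>V. D x z * B z x)"
    unfolding sum_distrib_right by (intro sum.cong refl) (simp add: B_const assms)
  also have "\<dots> = n * d / 2 * ?c"
    unfolding sum_D_B[OF assms assms] by (simp only: B_const[OF assms assms])
  finally show ?thesis using n_pos d_pos by simp
qed

lemma sum_D_mult:
  assumes "x \<in> V" "y \<in> V"
  shows "(\<Sum>z\<in>V. D x z * D y z) = n * d * (d + 1) / 4 - n / 2 * D x y"
proof -
  have "(\<Sum>z\<in>V. D x z * D y z) = (\<Sum>z\<in>V. D x z * D z y)"
    by (intro sum.cong refl) (metis D_commute)
  then show ?thesis using B_const[OF assms] unfolding B_def n_def by linarith
qed

text \<open>The sign vector of an arc: it separates the vertices that are closer to its tail from the others.\<close>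

definition side :: "'a \<times> 'a \<Rightarrow> 'a \<Rightarrow> real" where
  "side e z = D (fst e) z - D (snd e) z"

lemma side_values:
  assumes "e \<in> parcs G" "z \<in> V"
  shows "side e z = 1 \<or> side e z = -1"
  using D_diff_arc[of "fst e" "snd e" z] assms by (simp add: side_def power2_eq_1_iff)

lemma side_square: "e \<in> parcs G \<Longrightarrow> z \<in> V \<Longrightarrow> side e z * side e z = 1"
  using side_values by fastforce

lemma arc_ends_in: "e \<in> parcs G \<Longrightarrow> fst e \<in> V \<and> snd e \<in> V"
  using arc_fst_in_verts arc_snd_in_verts by blast

text \<open>The difference of two instances of \<open>sum_D_mult\<close>, in which the constants
  cancel: a sign vector is an eigenvector of \<open>D\<close> for \<open>-n/2\<close>.\<close>

lemma sum_D_side: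
  assumes "e \<in> parcs G" "x \<in> V"
  shows "(\<Sum>z\<in>V. D x z * side e z) = - (n / 2) * side e x"
proof -
  have "(\<Sum>z\<in>V. D x z * side e z) = (\<Sum>z\<in>V. D x z * D (fst e) z) - (\<Sum>z\<in>V. D x z * D (snd e) z)"
    by (simp only: side_def right_diff_distrib sum_subtractf)
  also have "\<dots> = - (n / 2) * (D x (fst e) - D x (snd e))"
    using arc_ends_in[OF assms(1)] assms(2)
    by (simp only: sum_D_mult) (simp add: right_diff_distrib)
  finally show ?thesis by (simp only: side_def D_commute)
qed

lemma sum_side:
  assumes "e \<in> parcs G"
  shows "(\<Sum>z\<in>V. side e z) = 0"
  using arc_ends_in[OF assms] by (simp add: side_def sum_subtractf sum_D)

section \<open>Inner products of sign vectors\<close>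

definition side_prod :: "'a \<times> 'a \<Rightarrow> 'a \<times> 'a \<Rightarrow> real" where
  "side_prod e f = (\<Sum>z\<in>V. side e z * side f z)"

lemma side_prod_commute: "side_prod e f = side_prod f e"
  by (simp add: side_prod_def mult.commute)

lemma side_prod_self: "e \<in> parcs G \<Longrightarrow> side_prod e e = n"
  by (simp add: side_prod_def side_square card_G n_def)

text \<open>Only the first sign vector is expanded into rows of \<open>D\<close>. As the difference
  on the right is \<open>0\<close>, \<open>2\<close> or \<open>-2\<close>, the inner product is
  \<open>0\<close>, \<open>n\<close> or \<open>-n\<close>; it is nonzero iff \<open>f\<close>
  separates the ends of \<open>e\<close>.\<close>

lemma side_prod_eq:
  assumes "e \<in> parcs G" "f \<in> parcs G"
  shows "side_prod e f = - (n / 2) * (side f (fst e) - side f (snd e))"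
proof -
  have "side_prod e f = (\<Sum>z\<in>V. D (fst e) z * side f z) - (\<Sum>z\<in>V. D (snd e) z * side f z)"
    by (simp only: side_prod_def side_def[of e] left_diff_distrib sum_subtractf)
  also have "\<dots> = - (n / 2) * (side f (fst e) - side f (snd e))"
    using arc_ends_in[OF assms(1)] assms(2)
    by (simp only: sum_D_side) (simp add: right_diff_distrib)
  finally show ?thesis .
qed

text \<open>A nonzero inner product is \<open>n\<close> or \<open>-n\<close>, while both vectors
  have squared norm \<open>n\<close>: this is the equality case of Cauchy-Schwarz.\<close>

lemma side_parallel:
  assumes e: "e \<in> parcs G" and f: "f \<in> parcs G" and nz: "side_prod e f \<noteq> 0"
  obtains s where "s = 1 \<or> s = -1" "\<And>z. z \<in> V \<Longrightarrow> side e z = s * side f z"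
proof -
  have ends: "fst e \<in> V" "snd e \<in> V" using arc_ends_in[OF e] by auto
  define s where "s = side_prod e f / n"
  have s: "s = 1 \<or> s = -1"
    using side_prod_eq[OF e f] nz side_values[OF f ends(1)] side_values[OF f ends(2)] n_pos
    by (auto simp: s_def)
  have "(\<Sum>z\<in>V. (side e z - s * side f z)\<^sup>2) =
      (\<Sum>z\<in>V. 1 + s\<^sup>2 - 2 * s * (side e z * side f z))"
    by (intro sum.cong refl)
      (simp add: power2_eq_square algebra_simps side_square e f)
  also have "\<dots> = 2 * n - 2 * s * side_prod e f"
    unfolding sum_subtractf side_prod_def sum_distrib_left[symmetric] using s by (auto simp: card_G n_def)
  also have "\<dots> = 0"
    using s n_pos by (auto simp: s_def field_simps)
  finally have "side e z = s * side f z" if "z \<in> V" for z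
    using that pair_finite_verts by (simp add: sum_nonneg_eq_0_iff)
  then show thesis using that s by blast
qed

definition orthogonal_arcs :: "('a \<times> 'a) set \<Rightarrow> bool" where
  "orthogonal_arcs F \<longleftrightarrow> F \<subseteq> parcs G \<and> (\<forall>e\<in>F. \<forall>f\<in>F. e \<noteq> f \<longrightarrow> side_prod e f = 0)"

text \<open>Bessel's inequality for the centred row of the distance matrix at an arbitrary vertex.\<close>

lemma card_orthogonal_arcs_le:
  assumes "orthogonal_arcs F"
  shows "card F \<le> d"
proof -
  have F: "F \<subseteq> parcs G" and orth: "\<And>e f. e \<in> F \<Longrightarrow> f \<in> F \<Longrightarrow> e \<noteq> f \<Longrightarrow> side_prod e f = 0"
    using assms by (auto simp: orthogonal_arcs_def)
  have fin: "finite F" using F pair_finite_arcs finite_subset by blast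
  obtain x where x: "x \<in> V" using card_G by (metis card.empty ex_in_conv power_not_zero zero_neq_numeral)
  \<comment> \<open>The row mean is \<open>d / 2\<close> by \<open>sum_D\<close>.\<close>
  define v where "v z = D x z - d / 2" for z
  \<comment> \<open>The projection of \<open>v\<close> onto the span of the sign vectors of
    \<open>F\<close> is \<open>- w / 2\<close>, since the coefficient at \<open>f\<close> is
    \<open>- side f x / 2\<close>.\<close>
  define w where "w z = (\<Sum>f\<in>F. side f x * side f z)" for z
  have vv: "(\<Sum>z\<in>V. v z * v z) = n * d / 4"
  proof -
    have "(\<Sum>z\<in>V. v z * v z) = (\<Sum>z\<in>V. D x z * D x z - d * D x z + d\<^sup>2 / 4)"
      by (intro sum.cong refl) (simp add: v_def field_simps power2_eq_square)
    also have "\<dots> = (\<Sum>z\<in>V. D x z * D x z) - d * (\<Sum>z\<in>V. D x z) + n * d\<^sup>2 / 4"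
      by (simp add: sum.distrib sum_subtractf card_G n_def flip: sum_distrib_left)
    finally show ?thesis
      unfolding sum_D_mult[OF x x] sum_D[OF x] D_self[OF x] by (simp add: field_simps power2_eq_square)
  qed
  have vf: "(\<Sum>z\<in>V. v z * side f z) = - (n / 2) * side f x" if "f \<in> F" for f
  proof -
    have f: "f \<in> parcs G" using that F by blast
    have "(\<Sum>z\<in>V. v z * side f z) = (\<Sum>z\<in>V. D x z * side f z) - d / 2 * (\<Sum>z\<in>V. side f z)"
      unfolding v_def left_diff_distrib sum_subtractf by (simp only: sum_distrib_left)
    then show ?thesis using sum_D_side[OF f x] sum_side[OF f] by simp
  qed
  have vw: "(\<Sum>z\<in>V. v z * w z) = - (n / 2) * card F"
  proof -
    have "(\<Sum>z\<in>V. v z * w z) = (\<Sum>f\<in>F. \<Sum>z\<in>V. side f x * (v z * side f z))"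
      unfolding w_def sum_distrib_left by (subst sum.swap) (simp add: mult_ac)
    also have "\<dots> = (\<Sum>f\<in>F. - (n / 2) * (side f x * side f x))"
      by (intro sum.cong refl) (simp add: vf flip: sum_distrib_left)
    also have "\<dots> = (\<Sum>f\<in>F. - (n / 2))"
      by (intro sum.cong refl) (use F x side_square in auto)
    finally show ?thesis by simp
  qed
  have ww: "(\<Sum>z\<in>V. w z * w z) = n * card F"
  proof -
    have "(\<Sum>z\<in>V. w z * w z) =
        (\<Sum>z\<in>V. \<Sum>f\<in>F. \<Sum>g\<in>F. side f x * side g x * (side f z * side g z))"
      unfolding w_def sum_product by (simp add: mult_ac)
    also have "\<dots> = (\<Sum>f\<in>F. \<Sum>z\<in>V. \<Sum>g\<in>F. side f x * side g x * (side f z * side g z))"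
      by (rule sum.swap)
    also have "\<dots> = (\<Sum>f\<in>F. \<Sum>g\<in>F. \<Sum>z\<in>V. side f x * side g x * (side f z * side g z))"
      by (rule sum.cong[OF refl]) (rule sum.swap)
    also have "\<dots> = (\<Sum>f\<in>F. \<Sum>g\<in>F. side f x * side g x * side_prod f g)"
      by (simp only: side_prod_def sum_distrib_left)
    also have "\<dots> = (\<Sum>f\<in>F. \<Sum>g\<in>F. if g = f then n else 0)"
      by (intro sum.cong refl) (use F x side_square side_prod_self orth in auto)
    also have "\<dots> = n * card F" using fin by simp
    finally show ?thesis .
  qed
  \<comment> \<open>The squared norm of the residual works out as \<open>n / 4\<close> times
    \<open>d - card F\<close>.\<close>
  have "0 \<le> (\<Sum>z\<in>V. (v z + w z / 2)\<^sup>2)" by (simp add: sum_nonneg)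
  also have "\<dots> = (\<Sum>z\<in>V. v z * v z + v z * w z + w z * w z / 4)"
    by (intro sum.cong refl) (simp add: field_simps power2_eq_square)
  also have "\<dots> = n * d / 4 - n / 4 * card F"
    by (simp add: sum.distrib vv vw ww flip: sum_divide_distrib)
  finally have "n / 4 * card F \<le> n / 4 * d" by simp
  then show ?thesis using n_pos by simp
qed

text \<open>A family of largest size exists because sizes are bounded by \<open>d\<close>; an arc
  orthogonal to all members could be added to it.\<close>

lemma maximal_orthogonal_arcs:
  obtains F where "orthogonal_arcs F" "\<And>e. e \<in> parcs G \<Longrightarrow> \<exists>f\<in>F. side_prod e f \<noteq> 0"
proof -
  have "orthogonal_arcs {}" by (simp add: orthogonal_arcs_def)
  moreover have "\<forall>F. orthogonal_arcs F \<longrightarrow> card F < Suc d"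
    using card_orthogonal_arcs_le by (simp add: less_Suc_eq_le)
  ultimately obtain F where F: "orthogonal_arcs F" "\<And>F'. orthogonal_arcs F' \<Longrightarrow> card F' \<le> card F"
    using ex_has_greatest_nat[of orthogonal_arcs "{}" card "Suc d"] by blast
  have "\<exists>f\<in>F. side_prod e f \<noteq> 0" if e: "e \<in> parcs G" for e
  proof (rule ccontr)
    assume "\<not> ?thesis"
    then have z: "side_prod e f = 0" if "f \<in> F" for f using that by blast
    have "e \<notin> F"
    proof
      assume "e \<in> F"
      from z[OF this] show False using side_prod_self[OF e] n_pos by simp
    qed
    have "orthogonal_arcs (insert e F)"
      using F(1) e z side_prod_commute by (auto simp: orthogonal_arcs_def)
    moreover have "finite F"
      using F(1) pair_finite_arcs finite_subset unfolding orthogonal_arcs_def by blast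
    ultimately show False using F(2)[of "insert e F"] \<open>e \<notin> F\<close> by simp
  qed
  then show thesis using that F(1) by blast
qed

section \<open>Coordinates from sign vectors\<close>

lemma side_ends:
  assumes "(x, y) \<in> parcs G"
  shows "side (x, y) x = -1" "side (x, y) y = 1"
  using D_arc[OF assms] D_arc[OF arcs_symmetric[OF assms]] D_self in_arcsD1[OF assms] in_arcsD2[OF assms]
  by (simp_all add: side_def)

text \<open>The first arc of a shortest walk from \<open>x\<close> to \<open>y\<close>. Its sign is
  1 at \<open>y\<close> and -1 at \<open>x\<close>, so it tells the two vertices apart.\<close>

lemma separating_arc:
  assumes "x \<in> V" "y \<in> V" "x \<noteq> y"
  obtains v where "(x, v) \<in> parcs G" "side (x, v) y = 1" "graph_dist G x y = Suc (graph_dist G v y)"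
proof -
  obtain v where "(x, v) \<in> parcs G" "graph_dist G x y = Suc (graph_dist G v y)"
    using graph_dist_step[OF connected_G assms] .
  then show thesis using that by (simp add: side_def)
qed

theorem digraph_iso_hypercube: "digraph_iso (with_proj G) (with_proj (hypercube d))"
proof -
  obtain F where F: "orthogonal_arcs F" and max: "\<And>e. e \<in> parcs G \<Longrightarrow> \<exists>f\<in>F. side_prod e f \<noteq> 0"
    using maximal_orthogonal_arcs by blast
  have FG: "f \<in> parcs G" if "f \<in> F" for f using F that by (auto simp: orthogonal_arcs_def)
  have "F \<subseteq> parcs G" using FG by blast
  then have "finite F" using pair_finite_arcs finite_subset by blast
  then obtain fs where fs: "set fs = F" "distinct fs" using finite_distinct_list by blast
  define \<Phi> where "\<Phi> z = map (\<lambda>f. if side f z = 1 then 1 else 0 :: nat) fs" for z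
  have \<Phi>_eq_iff: "(if side f z = 1 then 1 else 0 :: nat) = (if side f w = 1 then 1 else 0) \<longleftrightarrow> side f z = side f w"
    if "f \<in> F" "z \<in> V" "w \<in> V" for f z w
    using side_values[OF FG[OF that(1)] that(2)] side_values[OF FG[OF that(1)] that(3)] by auto
  \<comment> \<open>By maximality, \<open>F\<close> represents the sign vectors of all arcs up to
    sign.\<close>
  have rep: "\<exists>f\<in>F. \<exists>s. (s = 1 \<or> s = -1) \<and> (\<forall>z\<in>V. side e z = s * side f z)" if e: "e \<in> parcs G" for e
  proof -
    obtain f where f: "f \<in> F" "side_prod e f \<noteq> 0" using max[OF e] by blast
    obtain s where "s = 1 \<or> s = -1" "\<And>z. z \<in> V \<Longrightarrow> side e z = s * side f z"
      using side_parallel[OF e FG[OF f(1)] f(2)] by blast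
    then show ?thesis using f(1) by blast
  qed
  have sep: "\<exists>f\<in>F. side f z \<noteq> side f w" if zw: "z \<in> V" "w \<in> V" "z \<noteq> w" for z w
  proof -
    obtain v where v: "(z, v) \<in> parcs G" "side (z, v) w = 1"
      using separating_arc[OF zw] .
    obtain f s where f: "f \<in> F" "\<forall>u\<in>V. side (z, v) u = s * side f u" using rep[OF v(1)] by blast
    then have "side f z \<noteq> side f w" using v(2) side_ends(1)[OF v(1)] zw by force
    then show ?thesis using f(1) by blast
  qed
  have inj: "inj_on \<Phi> V"
  proof (rule inj_onI, rule ccontr)
    fix z w assume zw: "z \<in> V" "w \<in> V" "\<Phi> z = \<Phi> w" "z \<noteq> w"
    then obtain f where "f \<in> F" "side f z \<noteq> side f w" using sep by blast
    then show False using zw fs(1) \<Phi>_eq_iff by (auto simp: \<Phi>_def)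
  qed
  have sub: "\<Phi> ` V \<subseteq> pverts (hypercube (length fs))"
    by (auto simp: \<Phi>_def pverts_hypercube)
  have le: "length fs \<le> d"
    using card_orthogonal_arcs_le[OF F] fs distinct_card by metis
  \<comment> \<open>Injectivity needs at least \<open>d\<close> coordinates and Bessel's inequality
    allows at most \<open>d\<close>, so \<Phi> is a bijection onto the cube of dimension
    \<open>d\<close>.\<close>
  have "(2::nat) ^ d \<le> 2 ^ length fs"
    using card_inj_on_le[OF inj sub] pair_graph.axioms pair_graph_hypercube[of "length fs"]
      card_pverts_hypercube[of "length fs"] card_G
    by (metis card_gt_0_iff card_image card_mono sub zero_less_numeral zero_less_power)
  then have len: "length fs = d" using le by simp
  have finQ: "finite (pverts (hypercube d))"
    using card_pverts_hypercube[of d] by (metis card.infinite power_not_zero zero_neq_numeral)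
  have surj: "\<Phi> ` V = pverts (hypercube d)"
    using card_subset_eq[OF finQ] sub len card_image[OF inj] card_G card_pverts_hypercube by simp
  have ham: "hamming (\<Phi> z) (\<Phi> w) = card {f \<in> F. side f z \<noteq> side f w}" if "z \<in> V" "w \<in> V" for z w
  proof -
    have "{f \<in> F. side f z \<noteq> side f w} = (!) fs ` {i. i < length fs \<and> side (fs ! i) z \<noteq> side (fs ! i) w}"
    proof (intro equalityI subsetI)
      fix f assume f: "f \<in> {f \<in> F. side f z \<noteq> side f w}"
      then obtain i where "i < length fs" "fs ! i = f" using fs(1) by (auto simp: in_set_conv_nth)
      then show "f \<in> (!) fs ` {i. i < length fs \<and> side (fs ! i) z \<noteq> side (fs ! i) w}"
        using f by blast
    qed (use fs(1) in auto)
    moreover have "inj_on ((!) fs) {i. i < length fs \<and> side (fs ! i) z \<noteq> side (fs ! i) w}"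
      using inj_on_nth[OF fs(2)] by simp
    moreover have "{i. i < length (\<Phi> z) \<and> \<Phi> z ! i \<noteq> \<Phi> w ! i} =
        {i. i < length fs \<and> side (fs ! i) z \<noteq> side (fs ! i) w}"
    proof -
      have "\<Phi> z ! i = \<Phi> w ! i \<longleftrightarrow> side (fs ! i) z = side (fs ! i) w" if i: "i < length fs" for i
      proof -
        have "fs ! i \<in> F" using fs(1) i nth_mem by blast
        from \<Phi>_eq_iff[OF this \<open>z \<in> V\<close> \<open>w \<in> V\<close>] show ?thesis
          unfolding \<Phi>_def nth_map[OF i] .
      qed
      moreover have "length (\<Phi> z) = length fs" by (simp add: \<Phi>_def)
      ultimately show ?thesis by auto
    qed
    ultimately show ?thesis by (simp add: hamming_def card_image)
  qed
  have adj: "(z, w) \<in> parcs G \<longleftrightarrow> hamming (\<Phi> z) (\<Phi> w) = 1" if z: "z \<in> V" and w: "w \<in> V" for z w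
  proof
    assume zw: "(z, w) \<in> parcs G"
    \<comment> \<open>Members of \<open>F\<close> that separate the ends of an arc are parallel to
      its sign vector, hence not orthogonal to each other.\<close>
    have unique: "f = g" if f: "f \<in> F" "side f z \<noteq> side f w" and g: "g \<in> F" "side g z \<noteq> side g w" for f g
    proof (rule ccontr)
      assume "f \<noteq> g"
      have nz: "side_prod (z, w) f \<noteq> 0" "side_prod (z, w) g \<noteq> 0"
        using side_prod_eq[OF zw FG[OF f(1)]] side_prod_eq[OF zw FG[OF g(1)]] f(2) g(2) n_pos by auto
      obtain s where s: "s = 1 \<or> s = -1" "\<And>u. u \<in> V \<Longrightarrow> side (z, w) u = s * side f u"
        using side_parallel[OF zw FG[OF f(1)] nz(1)] by blast
      have "side_prod (z, w) g = s * side_prod f g"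
        unfolding side_prod_def sum_distrib_left by (intro sum.cong refl) (simp add: s(2))
      then show False
        using nz(2) F f(1) g(1) \<open>f \<noteq> g\<close> by (auto simp: orthogonal_arcs_def)
    qed
    obtain f where f: "f \<in> F" "side f z \<noteq> side f w" using sep[OF z w no_loops'[OF zw]] by blast
    then have "{f \<in> F. side f z \<noteq> side f w} = {f}" using unique by blast
    then show "hamming (\<Phi> z) (\<Phi> w) = 1" unfolding ham[OF z w] by simp
  next
    assume "hamming (\<Phi> z) (\<Phi> w) = 1"
    then obtain f where single: "{f \<in> F. side f z \<noteq> side f w} = {f}"
      unfolding ham[OF z w] by (auto simp: card_1_singleton_iff)
    have zw: "z \<noteq> w" using single by auto
    \<comment> \<open>Step from \<open>z\<close> towards \<open>w\<close> to reach \<open>v\<close>.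
      If \<open>v\<close> is not \<open>w\<close>, step back from \<open>w\<close> towards
      \<open>v\<close> to reach \<open>y\<close>. Both arcs separate \<open>z\<close> from
      \<open>w\<close>, so both are represented by the single \<open>f\<close>.\<close>
    obtain v where v: "(z, v) \<in> parcs G" "side (z, v) w = 1" "graph_dist G z w = Suc (graph_dist G v w)"
      using separating_arc[OF z w zw] .
    have vV: "v \<in> V" using in_arcsD2[OF v(1)] .
    show "(z, w) \<in> parcs G"
    proof (rule ccontr)
      assume na: "(z, w) \<notin> parcs G"
      then have "w \<noteq> v" using v(1) by blast
      then obtain y where y: "(w, y) \<in> parcs G" "side (w, y) v = 1"
          "graph_dist G w v = Suc (graph_dist G y v)"
        using separating_arc[OF w vV] by blast
      \<comment> \<open>The step from \<open>w\<close> to \<open>y\<close> also leads closer to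
        \<open>z\<close>, because \<open>v\<close> lies on a shortest walk between \<open>z\<close>
        and \<open>w\<close>.\<close>
      have "graph_dist G y z \<le> Suc (graph_dist G y v)"
        using graph_dist_arc_le[OF connected_G v(1) in_arcsD2[OF y(1)]]
        by (simp add: graph_dist_commute)
      then have "graph_dist G y z < graph_dist G w z"
        using v(3) y(3) by (simp add: graph_dist_commute)
      then have yz: "side (w, y) z = 1"
        using side_values[OF y(1) z] by (auto simp: side_def)
      have same: "g = f" if "g \<in> F" "side g z \<noteq> side g w" for g
        using single that by blast
      obtain g s where g: "g \<in> F" "\<forall>u\<in>V. side (z, v) u = s * side g u" "s = 1 \<or> s = -1"
        using rep[OF v(1)] by blast
      obtain h t where h: "h \<in> F" "\<forall>u\<in>V. side (w, y) u = t * side h u" "t = 1 \<or> t = -1"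
        using rep[OF y(1)] by blast
      have "side g z \<noteq> side g w" using g(2) z w v(2) side_ends(1)[OF v(1)] by force
      moreover have "side h z \<noteq> side h w" using h(2) z w yz side_ends(1)[OF y(1)] by force
      ultimately have "g = h" using same g(1) h(1) by blast
      \<comment> \<open>The first arc gives \<open>z\<close> and \<open>v\<close> opposite signs and
        the second gives them equal signs, although both sign vectors are multiples of
        \<open>side g\<close>.\<close>
      have "s * side g z = -1" "s * side g v = 1" "t * side g z = 1" "t * side g v = 1"
        using g(2) h(2) z vV side_ends[OF v(1)] y(2) yz \<open>g = h\<close> by auto
      then show False using g(3) h(3) by auto
    qed
  qed
  \<comment> \<open>Arcs of the image are again pairs of vertices, so its tail and head maps are the
    projections.\<close>
  define h where "h = \<lparr>iso_verts = \<Phi>, iso_arcs = map_prod \<Phi> \<Phi>, iso_head = snd, iso_tail = fst\<rparr>"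
  have "inj_on (map_prod \<Phi> \<Phi>) (parcs G)"
    using map_prod_inj_on[OF inj inj] by (rule inj_on_subset) (auto dest: in_arcsD1 in_arcsD2)
  then have "pre_digraph.digraph_isomorphism (with_proj G) h"
    unfolding pre_digraph.digraph_isomorphism_def using inj wf_digraph_axioms by (simp add: h_def)
  moreover have "map_prod \<Phi> \<Phi> ` parcs G = parcs (hypercube d)"
  proof
    show "map_prod \<Phi> \<Phi> ` parcs G \<subseteq> parcs (hypercube d)"
    proof (rule image_subsetI)
      fix e assume "e \<in> parcs G"
      then obtain z w where e: "e = (z, w)" and zw: "(z, w) \<in> parcs G" by (cases e) auto
      then have "z \<in> V" "w \<in> V" using in_arcsD1 in_arcsD2 by blast+
      moreover from this have "\<Phi> z \<in> pverts (hypercube d)" "\<Phi> w \<in> pverts (hypercube d)"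
        unfolding surj[symmetric] by blast+
      ultimately show "map_prod \<Phi> \<Phi> e \<in> parcs (hypercube d)"
        using adj zw by (simp add: parcs_hypercube e)
    qed
    show "parcs (hypercube d) \<subseteq> map_prod \<Phi> \<Phi> ` parcs G"
    proof (rule subrelI)
      fix a b assume ab: "(a, b) \<in> parcs (hypercube d)"
      then have "a \<in> \<Phi> ` V" "b \<in> \<Phi> ` V" unfolding surj by (auto simp: parcs_hypercube)
      then obtain z w where "z \<in> V" "w \<in> V" "a = \<Phi> z" "b = \<Phi> w" by blast
      then show "(a, b) \<in> map_prod \<Phi> \<Phi> ` parcs G"
        using ab adj by (auto simp: parcs_hypercube intro!: image_eqI[of _ _ "(z, w)"])
    qed
  qed
  then have "with_proj (hypercube d) = app_iso h (with_proj G)"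
    using surj by (simp add: app_iso_def with_proj_def h_def)
  ultimately show ?thesis unfolding digraph_iso_def by blast
qed

end

theorem theorem5p4:
  fixes d :: nat and G :: "'a pair_pre_digraph"
  assumes "d \<ge> 1"
    and "pair_graph G"
    and "Digraph_Component.connected (with_proj G)"
    and "distance_cospectral G (hypercube d)"
  shows "digraph_iso (with_proj G) (with_proj (hypercube d))"
proof -
  note cosp = distance_cospectralD[OF assms(2) pair_graph_hypercube assms(4)]
  interpret pair_graph G by (rule assms(2))
  interpret cube_cospectral G d
  proof unfold_locales
    show "card (pverts G) = 2 ^ d"
      using cosp(1) by (simp add: card_pverts_hypercube)
    show "(\<Sum>x\<in>pverts G. \<Sum>y\<in>pverts G. (real_dist G x y)\<^sup>2) =
        2 ^ d * (2 ^ d * real d * (real d + 1) / 4)"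
      using cosp(2) by (simp only: sum_graph_dist_square_hypercube)
    show "distance_cubic (2 ^ d / 2 - 2 ^ d * real d / 2) (- (2 ^ d * real d / 2 * (2 ^ d / 2))) G x y = 0"
      if "x \<in> pverts G" "y \<in> pverts G" for x y
      using cosp(3)[OF distance_cubic_hypercube that] .
  qed (use assms in auto)
  show ?thesis by (rule digraph_iso_hypercube)
qed

end
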